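(* Let $S=K[x_1,\dots,x_n]$ be a polynomial ring over a field $K$ and let $I\subset S$ be a squarefree monomial ideal with minimal prime ideals $P_1,\dots,P_s$. Suppose that the sum of every three different minimal prime ideals of $I$ is the maximal ideal $m=(x_1,\dots,x_n)$ of $S$, or more generally that there is a fixed ideal $J$ of $S$ such that $P_i+P_j+P_k=J$ for all pairwise distinct $i,j,k\in\{1,\dots,s\}$. Then $\operatorname{sdepth}_S I\ge \operatorname{depth}_S I$.
   Context: Depth is taken with respect to $m=(x_1,\dots,x_n)$. For a nonzero monomial ideal $I\subset S$, a Stanley decomposition of $I$ is a presentation $\mathcal D:\ I=\bigoplus_{i=1}^r u_iK[Z_i]$ of $I$ as a finite direct sum of $K$-linear subspaces, where $u_i\in I$ is a monomial, $Z_i\subset\{x_1,\dots,x_n\}$, and $u_iK[Z_i]=\{u_if: f\in K[Z_i]\}$. Set $\operatorname{sdepth}(\mathcal D)=\min\{|Z_i|: i=1,\dots,r\}$ and $\operatorname{sdepth}_S I=\max\{\operatorname{sdepth}(\mathcal D): \mathcal D \text{ a Stanley decomposition of } I\}$. *)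

theory Defs
  imports
    "HOL-Library.Poly_Mapping"
    "HOL-Library.Extended_Nat"
    "HOL-Algebra.Ideal_Product"
    "HOL-Algebra.Algebraic_Closure_Type"
begin

text \<open>
  The variables are indexed by a finite type \<open>'v\<close>, so that \<open>n = CARD('v)\<close>. A power product is
  represented by its exponent vector of type \<open>'v \<Rightarrow>\<^sub>0 nat\<close>; multiplication of polynomials is the
  convolution product of \<open>Poly_Mapping\<close>.
\<close>

type_synonym ('v, 'k) mpoly = "('v \<Rightarrow>\<^sub>0 nat) \<Rightarrow>\<^sub>0 'k"

abbreviation mpoly_ring :: "(('v, 'k::field) mpoly) ring"
  where "mpoly_ring \<equiv> ring_of_type_algebra"

definition monomial :: "('v \<Rightarrow>\<^sub>0 nat) \<Rightarrow> ('v, 'k::field) mpoly"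
  where "monomial u = Poly_Mapping.single u 1"

definition var :: "'v \<Rightarrow> ('v, 'k::field) mpoly"
  where "var v = monomial (Poly_Mapping.single v 1)"

definition max_ideal :: "('v::finite, 'k::field) mpoly set"
  where "max_ideal = genideal mpoly_ring (range var)"

definition squarefree_monomial_ideal :: "('v::finite, 'k::field) mpoly set \<Rightarrow> bool"
  where "squarefree_monomial_ideal I \<longleftrightarrow>
    (\<exists>A. (\<forall>u\<in>A. \<forall>v. Poly_Mapping.lookup u v \<le> 1) \<and> I = genideal mpoly_ring (monomial ` A))"

definition minimal_primes :: "('a, 'b) ring_scheme \<Rightarrow> 'a set \<Rightarrow> 'a set set"
  where "minimal_primes R I =
    {P. primeideal P R \<and> I \<subseteq> P \<and> (\<forall>Q. primeideal Q R \<and> I \<subseteq> Q \<and> Q \<subseteq> P \<longrightarrow> Q = P)}"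


text \<open>
  Regular sequences \<open>f\<^sub>1, \<dots>, f\<^sub>d\<close> on an ideal \<open>I\<close>, where \<open>I\<close> itself (not \<open>R/I\<close>) is the \<open>R\<close>-module:
  each \<open>f\<^sub>i\<close> is a nonzerodivisor on \<open>I / (f\<^sub>1, \<dots>, f\<^bsub>i-1\<^esub>)I\<close>, written out in terms of representatives,
  and \<open>I / (f\<^sub>1, \<dots>, f\<^sub>d)I\<close> is nonzero.
\<close>

definition regular_sequence_on :: "('a, 'b) ring_scheme \<Rightarrow> 'a set \<Rightarrow> 'a list \<Rightarrow> bool"
  where "regular_sequence_on R I fs \<longleftrightarrow>
    set fs \<subseteq> carrier R \<and>
    (\<forall>i<length fs. \<forall>a\<in>I.
       (fs ! i) \<otimes>\<^bsub>R\<^esub> a \<in> ideal_prod R (genideal R (set (take i fs))) I \<longrightarrow>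
       a \<in> ideal_prod R (genideal R (set (take i fs))) I) \<and>
    ideal_prod R (genideal R (set fs)) I \<noteq> I"

text \<open>
  Depth of the \<open>R\<close>-module \<open>I\<close> with respect to the ideal \<open>M\<close>. The supremum is taken in \<open>enat\<close> because
  the supremum of an unbounded set of type \<open>nat\<close> would be meaningless.
\<close>

definition depth :: "('a, 'b) ring_scheme \<Rightarrow> 'a set \<Rightarrow> 'a set \<Rightarrow> enat"
  where "depth R M I =
    (SUP fs \<in> {fs. set fs \<subseteq> M \<and> regular_sequence_on R I fs}. enat (length fs))"


definition polys_in :: "'v set \<Rightarrow> ('v, 'k::field) mpoly set"
  where "polys_in Z = {f. \<forall>u\<in>Poly_Mapping.keys f. Poly_Mapping.keys u \<subseteq> Z}"

definition stanley_space :: "('v \<Rightarrow>\<^sub>0 nat) \<times> 'v set \<Rightarrow> ('v, 'k::field) mpoly set"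
  where "stanley_space = (\<lambda>(u, Z). {monomial u * f |f. f \<in> polys_in Z})"

text \<open>
  Internal direct sum \<open>I = V\<^sub>0 \<oplus> \<dots> \<oplus> V\<^bsub>r-1\<^esub>\<close> of additive subgroups.
\<close>

definition is_direct_sum :: "'a::ab_group_add set \<Rightarrow> nat \<Rightarrow> (nat \<Rightarrow> 'a set) \<Rightarrow> bool"
  where "is_direct_sum I r V \<longleftrightarrow>
    I = {\<Sum>i<r. g i |g. \<forall>i<r. g i \<in> V i} \<and>
    (\<forall>g. (\<forall>i<r. g i \<in> V i) \<and> (\<Sum>i<r. g i) = 0 \<longrightarrow> (\<forall>i<r. g i = 0))"

definition stanley_decomposition ::
    "('v::finite, 'k::field) mpoly set \<Rightarrow> (('v \<Rightarrow>\<^sub>0 nat) \<times> 'v set) list \<Rightarrow> bool"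
  where "stanley_decomposition I ds \<longleftrightarrow>
    (\<forall>(u, Z) \<in> set ds. monomial u \<in> I) \<and>
    is_direct_sum I (length ds) (\<lambda>i. stanley_space (ds ! i))"

text \<open>
  The minimum is over a nonempty set as soon as \<open>ds\<close> is a Stanley decomposition of a nonzero ideal,
  and the maximum below is over a set of numbers bounded by \<open>CARD('v)\<close>.
\<close>

definition sdepth_decomposition :: "(('v::finite \<Rightarrow>\<^sub>0 nat) \<times> 'v set) list \<Rightarrow> nat"
  where "sdepth_decomposition ds = Min ((\<lambda>(u, Z). card Z) ` set ds)"

definition sdepth :: "('v::finite, 'k::field) mpoly set \<Rightarrow> nat"
  where "sdepth I = Max {sdepth_decomposition ds |ds. stanley_decomposition I ds}"

end

theory Submission
  imports Defs
begin

text \<open>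
  Call a set of variables a face if its product is not in \<open>I\<close>. The faces form a simplicial complex,
  a polynomial lies in \<open>I\<close> iff the support of each of its monomials is a nonface, and a facet \<open>F\<close> gives
  the minimal prime generated by the variables outside \<open>F\<close>. The hypothesis therefore says that all
  intersections of three distinct facets are equal, hence equal to the intersection \<open>C\<close> of all facets.
  The complex is a cone over \<open>C\<close>. If there are at least two facets, then its part outside \<open>C\<close> has the
  homotopy type of the graph whose vertices are the facets and whose edges are the pairs \<open>F, G\<close> with
  \<open>F \<inter> G \<noteq> C\<close>.

  Let \<open>d\<close> be the length of a sequence in the maximal ideal that is regular on \<open>I\<close>. The proof
  splits the nonfaces into intervals \<open>{A..B}\<close> with \<open>card B \<ge> d\<close>; the spaces \<open>x\<^sup>A K[B]\<close> then form
  a Stanley decomposition (\<open>sdepth_ge_partitionable\<close>).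

  Upper bounds on \<open>d\<close> come from Koszul cohomology: a regular sequence of length \<open>d\<close> forces the
  cohomology of \<open>I\<close> with respect to the variables to vanish in degrees below \<open>d\<close>
  (\<open>regular_sequence_koszul_vanishing\<close>). So every explicit cocycle of degree \<open>i\<close> that is not a
  coboundary gives \<open>d \<le> i\<close>. All the cocycles needed are wedge products \<open>e\<^sub>N \<and> d\<^sub>0 \<and> \<dots>\<close> where the
  variables outside \<open>N\<close> are split into blocks and \<open>d\<^sub>i\<close> is the sum of \<open>x\<^sub>v e\<^sub>v\<close> over the \<open>i\<close>-th block.
  Two blocks detect that deleting \<open>N\<close> disconnects the complex, and then \<open>d \<le> card N + 2\<close>. Three blocks
  detect an edge of the facet graph that lies on a cycle, and then \<open>d \<le> card C + 3\<close>.

  The intervals are constructed outside \<open>C\<close>, whose elements are added to the upper ends afterwards, and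
  first for the nonfaces that consist of vertices. With at least two facets, there are three cases.
  If the facet graph is disconnected, then \<open>d \<le> card C + 2\<close>, and every such nonface already has two
  elements. If it is connected and \<open>d \<le> card C + 3\<close>, each nonface with two elements is paired with a
  nonface with three elements, using a neighbour through which its later vertex was attached.
  Otherwise the graph is a tree and \<open>d \<le> card (F \<inter> G) + 2\<close> for every edge. The facets can then be
  attached one at a time, each along a single earlier facet, and the link of each new vertex in the
  part built before is a simplex with at least \<open>d - 2\<close> elements, counting \<open>C\<close>; this is what the
  elimination step \<open>partitionable_simplicial\<close> requires.
\<close>

section \<open>Ideals in type-class rings\<close>

lemma ideal_type_closed:
  fixes I :: "'a::comm_ring_1 set"
  assumes "ideal I ring_of_type_algebra"
  shows ideal_type_zero: "0 \<in> I"
    and ideal_type_add: "a \<in> I \<Longrightarrow> b \<in> I \<Longrightarrow> a + b \<in> I"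
    and ideal_type_mult: "a \<in> I \<Longrightarrow> r * a \<in> I"
    and ideal_type_diff: "a \<in> I \<Longrightarrow> b \<in> I \<Longrightarrow> a - b \<in> I"
    and ideal_type_sum: "(\<And>x. x \<in> Y \<Longrightarrow> f x \<in> I) \<Longrightarrow> sum f Y \<in> I"
proof -
  interpret ideal I ring_of_type_algebra by fact
  show z: "0 \<in> I"
    using additive_subgroup.zero_closed[OF is_additive_subgroup] by (simp add: ring_of_type_algebra_def)
  show a: "a + b \<in> I" if "a \<in> I" "b \<in> I" for a b
    using additive_subgroup.a_closed[OF is_additive_subgroup that] by (simp add: ring_of_type_algebra_def)
  show m: "r * a \<in> I" if "a \<in> I" for a r
    using I_l_closed[OF that, of r] by (simp add: ring_of_type_algebra_def)
  have n: "- a \<in> I" if "a \<in> I" for a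
    using m[OF that, of "-1"] by simp
  show "a - b \<in> I" if "a \<in> I" "b \<in> I" for a b
    using a[OF that(1) n[OF that(2)]] by simp
  show "(\<And>x. x \<in> Y \<Longrightarrow> f x \<in> I) \<Longrightarrow> sum f Y \<in> I" for f :: "'b \<Rightarrow> 'a" and Y
    by (induction Y rule: infinite_finite_induct) (simp_all add: z a)
qed

lemma ideal_typeI:
  fixes I :: "'a::comm_ring_1 set"
  assumes z: "0 \<in> I" and a: "\<And>a b. a \<in> I \<Longrightarrow> b \<in> I \<Longrightarrow> a + b \<in> I"
    and m: "\<And>r a. a \<in> I \<Longrightarrow> r * a \<in> I"
  shows "ideal I ring_of_type_algebra"
proof (rule idealI)
  let ?R = "ring_of_type_algebra :: 'a ring"
  interpret R: cring ?R by (rule cring_from_type_algebra)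
  show "ring ?R" by (rule R.ring_axioms)
  have n: "- a \<in> I" if "a \<in> I" for a
    using m[OF that, of "-1"] by simp
  show "subgroup I (add_monoid ?R)"
  proof (rule R.add.subgroupI)
    show "I \<subseteq> carrier (ring_of_type_algebra :: 'a ring)"
      by (simp add: ring_of_type_algebra_def)
    show "I \<noteq> {}" using z by blast
  next
    fix u assume u: "u \<in> I"
    have "\<ominus>\<^bsub>?R\<^esub> u = - u"
      by (rule R.minus_equality) (simp_all add: ring_of_type_algebra_def)
    then show "\<ominus>\<^bsub>?R\<^esub> u \<in> I" using n[OF u] by simp
  next
    fix u v assume "u \<in> I" "v \<in> I"
    then show "u \<oplus>\<^bsub>?R\<^esub> v \<in> I" using a by (simp add: ring_of_type_algebra_def)
  qed
  show "x \<otimes>\<^bsub>?R\<^esub> u \<in> I" "u \<otimes>\<^bsub>?R\<^esub> x \<in> I" if "u \<in> I" for u x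
    using m[OF that, of x] by (simp_all add: ring_of_type_algebra_def mult.commute)
qed

lemma genideal_type_subset:
  fixes I :: "'a::comm_ring_1 set"
  assumes "ideal I ring_of_type_algebra" "Y \<subseteq> I"
  shows "genideal ring_of_type_algebra Y \<subseteq> I"
  using ring.genideal_minimal[OF ring_from_type_algebra] assms by blast

lemma ideal_genideal_type: "ideal (genideal ring_of_type_algebra Y) (ring_of_type_algebra :: 'a::comm_ring_1 ring)"
  and subset_genideal_type: "Y \<subseteq> genideal (ring_of_type_algebra :: 'a::comm_ring_1 ring) Y"
  using ring.genideal_ideal[OF ring_from_type_algebra, of Y]
    ring.genideal_self[OF ring_from_type_algebra, of Y]
  by (simp_all add: ring_of_type_algebra_def)


section \<open>The Koszul complex and regular sequences\<close>

text \<open>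
  The function \<open>c\<close> on sets of variables stands for the element \<open>\<Sum>\<^sub>W c(W) e\<^sub>W\<close> of the exterior algebra;
  the injective numbering \<open>idx\<close> fixes the order of the factors in \<open>e\<^sub>W\<close>. Then \<open>koszul_d\<close> is the wedge
  product with \<open>\<Sum>\<^sub>v x\<^sub>v e\<^sub>v\<close> from the left, and \<open>koszul_h\<close> is the contraction with the functional
  \<open>e\<^sub>v \<mapsto> g\<^sub>v\<close>.
\<close>

definition koszul_sign :: "('v::finite \<Rightarrow> nat) \<Rightarrow> 'v \<Rightarrow> 'v set \<Rightarrow> 'a::comm_ring_1"
  where "koszul_sign idx v W = (-1) ^ card {u \<in> W. idx u < idx v}"

definition koszul_d :: "('v::finite \<Rightarrow> nat) \<Rightarrow> ('v \<Rightarrow> 'a::comm_ring_1) \<Rightarrow> ('v set \<Rightarrow> 'a) \<Rightarrow> 'v set \<Rightarrow> 'a"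
  where "koszul_d idx x c W = (\<Sum>v\<in>W. koszul_sign idx v W * x v * c (W - {v}))"

definition koszul_h :: "('v::finite \<Rightarrow> nat) \<Rightarrow> ('v \<Rightarrow> 'a::comm_ring_1) \<Rightarrow> ('v set \<Rightarrow> 'a) \<Rightarrow> 'v set \<Rightarrow> 'a"
  where "koszul_h idx g c W = (\<Sum>v\<in>- W. koszul_sign idx v W * g v * c (insert v W))"

lemma koszul_sign_insert:
  assumes "u \<notin> W"
  shows "koszul_sign idx v (insert u W) =
    (if idx u < idx v then - koszul_sign idx v W else koszul_sign idx v W)"
proof -
  have "{w \<in> insert u W. idx w < idx v} =
      (if idx u < idx v then insert u {w \<in> W. idx w < idx v} else {w \<in> W. idx w < idx v})"
    by auto
  then show ?thesis using assms by (simp add: koszul_sign_def)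
qed

lemma koszul_sign_square [simp]: "koszul_sign idx v W * koszul_sign idx v W = 1"
  by (simp add: koszul_sign_def flip: power_add)

lemma koszul_sign_remove:
  "koszul_sign idx v (W - {v}) = koszul_sign idx v W"
proof -
  have "{u \<in> W - {v}. idx u < idx v} = {u \<in> W. idx u < idx v}" by auto
  then show ?thesis by (simp add: koszul_sign_def)
qed

text \<open>
  The terms are cancelled in pairs. Comparing the sum with its negative would not be enough in
  characteristic two.
\<close>

lemma sum_antisymmetric_zero:
  fixes h :: "'v::finite \<Rightarrow> 'v \<Rightarrow> 'a::comm_ring_1" and idx :: "'v \<Rightarrow> nat"
  assumes inj: "inj idx"
    and anti: "\<And>u v. u \<in> W \<Longrightarrow> v \<in> W \<Longrightarrow> u \<noteq> v \<Longrightarrow> h u v = - h v u"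
  shows "(\<Sum>v\<in>W. \<Sum>u\<in>W - {v}. h v u) = 0"
proof -
  let ?L = "SIGMA v:W. {u \<in> W. idx u < idx v}" and ?G = "SIGMA v:W. {u \<in> W. idx v < idx u}"
  have "(\<Sum>v\<in>W. \<Sum>u\<in>W - {v}. h v u) = (\<Sum>(v, u)\<in>(SIGMA v:W. W - {v}). h v u)"
    by (rule sum.Sigma) auto
  also have "(SIGMA v:W. W - {v}) = ?L \<union> ?G"
    using inj by (auto dest: injD simp: inj_eq not_less_iff_gr_or_eq)
  also have "(\<Sum>(v, u)\<in>?L \<union> ?G. h v u) = (\<Sum>(v, u)\<in>?L. h v u) + (\<Sum>(v, u)\<in>?G. h v u)"
    by (rule sum.union_disjoint) auto
  also have "(\<Sum>(v, u)\<in>?G. h v u) = (\<Sum>(v, u)\<in>?L. h u v)"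
    by (rule sum.reindex_bij_witness[of _ prod.swap prod.swap]) auto
  also have "(\<Sum>(v, u)\<in>?L. h v u) + (\<Sum>(v, u)\<in>?L. h u v) = (\<Sum>(v, u)\<in>?L. h v u + h u v)"
    by (simp add: sum.distrib case_prod_beta)
  also have "\<dots> = 0"
    by (rule sum.neutral) (use anti in force)
  finally show ?thesis .
qed

lemma koszul_d_d:
  assumes inj: "inj idx"
  shows "koszul_d idx x (koszul_d idx x c) W = 0"
proof -
  let ?h = "\<lambda>v u. koszul_sign idx v W * x v * (koszul_sign idx u (W - {v}) * x u * c (W - {v} - {u}))"
  have "koszul_d idx x (koszul_d idx x c) W = (\<Sum>v\<in>W. \<Sum>u\<in>W - {v}. ?h v u)"
    by (simp add: koszul_d_def sum_distrib_left)
  also have "\<dots> = 0"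
  proof (rule sum_antisymmetric_zero[OF inj])
    fix u v assume uv: "u \<in> W" "v \<in> W" "u \<noteq> v"
    define B where "B = W - {v} - {u}"
    have W: "W = insert u (insert v B)" "u \<notin> B" "v \<notin> B" using uv by (auto simp: B_def)
    have e: "W - {v} = insert u B" "W - {u} = insert v B" "W - {u} - {v} = B"
      using W uv by auto
    have lt: "idx u < idx v \<or> idx v < idx u" using inj uv by (metis injD linorder_neqE_nat)
    show "?h u v = - ?h v u"
      unfolding e B_def[symmetric] unfolding W(1)
      using W(2,3) uv(3) lt by (auto simp: koszul_sign_insert algebra_simps)
  qed
  finally show ?thesis .
qed

text \<open>
  An element of the ideal generated by the \<open>x\<^sub>v\<close> acts as zero on cohomology, since multiplication by it
  is null-homotopic.
\<close>

lemma koszul_homotopy: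
  assumes inj: "inj idx"
  shows "koszul_d idx x (koszul_h idx g c) W + koszul_h idx g (koszul_d idx x c) W =
    (\<Sum>v\<in>UNIV. g v * x v) * c W"
proof -
  let ?s = "koszul_sign idx :: 'a \<Rightarrow> 'a set \<Rightarrow> 'b"
  have d: "koszul_d idx x (koszul_h idx g c) W =
      (\<Sum>v\<in>W. g v * x v * c W) +
      (\<Sum>v\<in>W. \<Sum>u\<in>- W. ?s v W * ?s u (W - {v}) * x v * g u * c (insert u (W - {v})))"
  proof -
    have "koszul_sign idx v W * x v * koszul_h idx g c (W - {v}) = g v * x v * c W +
      (\<Sum>u\<in>- W. ?s v W * ?s u (W - {v}) * x v * g u * c (insert u (W - {v})))"
      if v: "v \<in> W" for v
    proof -
      have e: "- (W - {v}) = insert v (- W)" using v by auto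
      have "koszul_sign idx v W * x v * koszul_h idx g c (W - {v}) =
          ?s v W * ?s v W * (x v * g v * c W) +
          ?s v W * x v * (\<Sum>u\<in>- W. ?s u (W - {v}) * g u * c (insert u (W - {v})))"
        unfolding koszul_h_def e using v
        by (simp add: koszul_sign_remove insert_absorb algebra_simps)
      then show ?thesis
        by (simp add: sum_distrib_left algebra_simps)
    qed
    then show ?thesis
      by (simp add: koszul_d_def sum.distrib)
  qed
  have h: "koszul_h idx g (koszul_d idx x c) W =
      (\<Sum>u\<in>- W. g u * x u * c W) +
      (\<Sum>u\<in>- W. \<Sum>v\<in>W. ?s u W * ?s v (insert u W) * x v * g u * c (insert u W - {v}))"
  proof -
    have "?s u W * g u * koszul_d idx x c (insert u W) = g u * x u * c W +
      (\<Sum>v\<in>W. ?s u W * ?s v (insert u W) * x v * g u * c (insert u W - {v}))"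
      if u: "u \<in> - W" for u
    proof -
      have s: "?s u (insert u W) = ?s u W" using u by (simp add: koszul_sign_insert)
      have "?s u W * g u * koszul_d idx x c (insert u W) =
          ?s u W * ?s u W * (g u * x u * c W) +
          ?s u W * g u * (\<Sum>v\<in>W. ?s v (insert u W) * x v * c (insert u W - {v}))"
        using u s by (simp add: koszul_d_def algebra_simps)
      then show ?thesis
        by (simp add: sum_distrib_left algebra_simps)
    qed
    then show ?thesis
      by (simp add: koszul_h_def sum.distrib)
  qed
  have cross: "(\<Sum>u\<in>- W. \<Sum>v\<in>W. ?s u W * ?s v (insert u W) * x v * g u * c (insert u W - {v})) =
     - (\<Sum>v\<in>W. \<Sum>u\<in>- W. ?s v W * ?s u (W - {v}) * x v * g u * c (insert u (W - {v})))"
  proof -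
    have "?s u W * ?s v (insert u W) * x v * g u * c (insert u W - {v}) =
      - (?s v W * ?s u (W - {v}) * x v * g u * c (insert u (W - {v})))"
      if uv: "u \<in> - W" "v \<in> W" for u v
    proof -
      define B where "B = W - {v}"
      have W: "W = insert v B" "v \<notin> B" "u \<notin> B" "u \<noteq> v" using uv by (auto simp: B_def)
      have e: "insert u W - {v} = insert u B" "insert u W = insert v (insert u B)"
        using W by auto
      have lt: "idx u < idx v \<or> idx v < idx u" using inj W(4) by (metis injD linorder_neqE_nat)
      show ?thesis
        unfolding e B_def[symmetric] unfolding W(1)
        using W(2-4) lt by (auto simp: koszul_sign_insert algebra_simps)
    qed
    then have "(\<Sum>u\<in>- W. \<Sum>v\<in>W. ?s u W * ?s v (insert u W) * x v * g u * c (insert u W - {v})) =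
      (\<Sum>u\<in>- W. \<Sum>v\<in>W. - (?s v W * ?s u (W - {v}) * x v * g u * c (insert u (W - {v}))))"
      by (intro sum.cong) auto
    also have "\<dots> = (\<Sum>v\<in>W. \<Sum>u\<in>- W. - (?s v W * ?s u (W - {v}) * x v * g u * c (insert u (W - {v}))))"
      by (rule sum.swap)
    finally show ?thesis by (simp add: sum_negf)
  qed
  have "(\<Sum>v\<in>UNIV. g v * x v) * c W = (\<Sum>v\<in>W \<union> - W. g v * x v * c W)"
    by (simp add: sum_distrib_right)
  also have "\<dots> = (\<Sum>v\<in>W. g v * x v * c W) + (\<Sum>v\<in>- W. g v * x v * c W)"
    by (rule sum.union_disjoint) auto
  finally show ?thesis
    unfolding d h cross by simp
qed

lemma koszul_d_add:
  "koszul_d idx x (\<lambda>W. a W + b W) W = koszul_d idx x a W + koszul_d idx x b W"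
  by (simp add: koszul_d_def algebra_simps sum.distrib)

lemma koszul_d_scale:
  "koszul_d idx x (\<lambda>W. r * a W) W = r * koszul_d idx x a W"
  by (simp add: koszul_d_def algebra_simps sum_distrib_left)

text \<open>
  Vanishing of cohomology in degrees below \<open>m = d - k\<close> for the module \<open>I / Q\<^sub>k\<close>, phrased with
  representatives in \<open>I\<close>. Multiplication by \<open>f = f\<^sub>k\<close> gives the exact sequence
  \<open>0 \<rightarrow> I / Q\<^sub>k \<rightarrow> I / Q\<^sub>k \<rightarrow> I / Q\<^bsub>k+1\<^esub> \<rightarrow> 0\<close>. For a cocycle \<open>c\<close> the homotopy shows that \<open>f c\<close> is the
  coboundary of some \<open>y\<close>, which is a cocycle modulo \<open>Q\<^bsub>k+1\<^esub>\<close> of one degree less. The induction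
  hypothesis writes \<open>y\<close> as a coboundary plus \<open>f w\<close>, and cancelling \<open>f\<close> shows that \<open>c\<close> is the
  coboundary of \<open>w\<close>.
\<close>

lemma koszul_vanishing_filtration:
  fixes x :: "'v::finite \<Rightarrow> 'a::comm_ring_1" and f :: "nat \<Rightarrow> 'a"
  assumes inj: "inj idx"
    and I: "ideal I ring_of_type_algebra"
    and Q: "\<And>k. ideal (Q k) ring_of_type_algebra" "\<And>k. Q k \<subseteq> I" "\<And>k. Q k \<subseteq> Q (Suc k)"
    and in_Q: "\<And>k a. k < d \<Longrightarrow> a \<in> I \<Longrightarrow> f k * a \<in> Q (Suc k)"
    and Q_split: "\<And>k b. k < d \<Longrightarrow> b \<in> Q (Suc k) \<Longrightarrow> \<exists>a\<in>I. b - f k * a \<in> Q k"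
    and regular: "\<And>k a. k < d \<Longrightarrow> a \<in> I \<Longrightarrow> f k * a \<in> Q k \<Longrightarrow> a \<in> Q k"
    and f: "\<And>k. k < d \<Longrightarrow> \<exists>g. f k = (\<Sum>v\<in>UNIV. g v * x v)"
  assumes "k + m = d" "\<And>W. c W \<in> I" "\<And>W. m \<le> card W \<Longrightarrow> c W = 0"
    "\<And>W. koszul_d idx x c W \<in> Q k"
  shows "\<exists>w. (\<forall>W. w W \<in> I) \<and> (\<forall>W. m \<le> Suc (card W) \<longrightarrow> w W = 0) \<and>
    (\<forall>W. c W - koszul_d idx x w W \<in> Q k)"
  using assms(10-)
proof (induction m arbitrary: k c)
  case 0
  then show ?case
    by (intro exI[of _ "\<lambda>_. 0"]) (simp add: koszul_d_def ideal_type_zero I Q(1))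
next
  case (Suc m)
  have k: "k < d" using Suc.prems(1) by simp
  obtain g where g: "f k = (\<Sum>v\<in>UNIV. g v * x v)" using f[OF k] by blast
  define y where "y = koszul_h idx g c"
  define r where "r = koszul_h idx g (koszul_d idx x c)"
  have r: "r W \<in> Q k" for W
    unfolding r_def koszul_h_def
    by (intro ideal_type_sum[OF Q(1)] ideal_type_mult[OF Q(1)] Suc.prems)
  have dy: "koszul_d idx x y W = f k * c W - r W" for W
    using koszul_homotopy[OF inj, of x g c W] by (simp add: y_def r_def g algebra_simps)
  have yI: "y W \<in> I" for W
    unfolding y_def koszul_h_def
    by (intro ideal_type_sum[OF I] ideal_type_mult[OF I] Suc.prems)
  have y0: "y W = 0" if "m \<le> card W" for W
    unfolding y_def koszul_h_def
    by (intro sum.neutral ballI) (use that Suc.prems(3) in auto)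
  have "\<exists>w. (\<forall>W. w W \<in> I) \<and> (\<forall>W. m \<le> Suc (card W) \<longrightarrow> w W = 0) \<and>
    (\<forall>W. y W - koszul_d idx x w W \<in> Q (Suc k))"
  proof (rule Suc.IH)
    show "Suc k + m = d" using Suc.prems by simp
    show "koszul_d idx x y W \<in> Q (Suc k)" for W
      unfolding dy using in_Q[OF k Suc.prems(2)] r Q(3)
      by (intro ideal_type_diff[OF Q(1)]) auto
  qed (use yI y0 in auto)
  then obtain z where z: "\<And>W. z W \<in> I" "\<And>W. m \<le> Suc (card W) \<Longrightarrow> z W = 0"
    "\<And>W. y W - koszul_d idx x z W \<in> Q (Suc k)" by blast
  have "\<forall>W. \<exists>a\<in>I. y W - koszul_d idx x z W - f k * a \<in> Q k"
    using Q_split[OF k] z(3) by blast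
  then obtain w0 where w0: "\<And>W. w0 W \<in> I" "\<And>W. y W - koszul_d idx x z W - f k * w0 W \<in> Q k"
    by metis
  \<comment> \<open>the choice \<open>w0\<close> is cut off to have the right degree; no harm is done because \<open>y\<close> and \<open>dz\<close> vanish there\<close>
  define w where "w W = (if m \<le> card W then 0 else w0 W)" for W
  define q where "q W = y W - koszul_d idx x z W - f k * w W" for W
  have dz0: "koszul_d idx x z W = 0" if W: "m \<le> card W" for W
  proof -
    have "m \<le> Suc (card (W - {v}))" if "v \<in> W" for v
      using W that by (simp add: card_Suc_Diff1)
    then show ?thesis
      unfolding koszul_d_def by (intro sum.neutral ballI) (simp add: z(2))
  qed
  have q: "q W \<in> Q k" for W
    using w0(2)[of W] y0[of W] dz0[of W] ideal_type_zero[OF Q(1)] by (simp add: q_def w_def)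
  have y: "y = (\<lambda>W. koszul_d idx x z W + (f k * w W + q W))"
    by (simp add: q_def)
  have "koszul_d idx x y W = f k * koszul_d idx x w W + koszul_d idx x q W" for W
    unfolding y koszul_d_add koszul_d_d[OF inj] koszul_d_scale by simp
  then have "f k * (c W - koszul_d idx x w W) = koszul_d idx x q W + r W" for W
    using dy[of W] by (simp add: algebra_simps)
  moreover have "koszul_d idx x q W \<in> Q k" for W
    unfolding koszul_d_def by (intro ideal_type_sum[OF Q(1)] ideal_type_mult[OF Q(1)] q)
  ultimately have "f k * (c W - koszul_d idx x w W) \<in> Q k" for W
    using ideal_type_add[OF Q(1)] r by simp
  moreover have wI: "w W \<in> I" for W using w0(1) ideal_type_zero[OF I] by (simp add: w_def)
  moreover have "koszul_d idx x w W \<in> I" for W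
    unfolding koszul_d_def by (intro ideal_type_sum[OF I] ideal_type_mult[OF I] wI)
  ultimately have "c W - koszul_d idx x w W \<in> Q k" for W
    using regular[OF k] ideal_type_diff[OF I] Suc.prems(2) by blast
  moreover have "w W = 0" if "Suc m \<le> Suc (card W)" for W
    using that by (simp add: w_def)
  ultimately show ?case
    using wI by blast
qed

text \<open>
  The submodules \<open>(f\<^sub>1, \<dots>, f\<^sub>k)I\<close> of the definition of regular sequences grow by \<open>f\<^bsub>k+1\<^esub>I\<close> only; this is
  the filtration to which the vanishing lemma applies.
\<close>

lemma ideal_prod_genideal_insert:
  fixes I :: "'a::comm_ring_1 set"
  assumes I: "ideal I ring_of_type_algebra"
    and b: "b \<in> ideal_prod ring_of_type_algebra (genideal ring_of_type_algebra (insert f Y)) I"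
  shows "\<exists>a\<in>I. b - f * a \<in> ideal_prod ring_of_type_algebra (genideal ring_of_type_algebra Y) I"
proof -
  let ?R = "ring_of_type_algebra :: 'a ring"
  let ?J = "genideal ?R Y"
  have P: "ideal (ideal_prod ?R ?J I) ?R"
    by (intro ring.ideal_prod_is_ideal[OF ring_from_type_algebra] ideal_genideal_type I)
  have gen: "genideal ?R (insert f Y) \<subseteq> {j + r * f |j r. j \<in> ?J}"
  proof (rule genideal_type_subset[OF ideal_typeI])
    have J: "0 \<in> ?J" by (intro ideal_type_zero ideal_genideal_type)
    then show "0 \<in> {j + r * f |j r. j \<in> ?J}" by (intro CollectI exI[of _ 0]) auto
    show "insert f Y \<subseteq> {j + r * f |j r. j \<in> ?J}"
    proof
      fix u assume "u \<in> insert f Y"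
      then show "u \<in> {j + r * f |j r. j \<in> ?J}"
      proof
        assume "u = f"
        then show ?thesis using J by (intro CollectI exI[of _ 0] exI[of _ 1]) auto
      next
        assume "u \<in> Y"
        then show ?thesis using subset_genideal_type
          by (intro CollectI exI[of _ u] exI[of _ 0]) auto
      qed
    qed
  next
    fix a b assume "a \<in> {j + r * f |j r. j \<in> ?J}" "b \<in> {j + r * f |j r. j \<in> ?J}"
    then obtain j r j' r' where "a = j + r * f" "b = j' + r' * f" "j \<in> ?J" "j' \<in> ?J" by blast
    then show "a + b \<in> {j + r * f |j r. j \<in> ?J}"
      by (intro CollectI exI[of _ "j + j'"] exI[of _ "r + r'"])
        (auto simp: algebra_simps intro: ideal_type_add[OF ideal_genideal_type])
  next
    fix a s assume "a \<in> {j + r * f |j r. j \<in> ?J}"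
    then obtain j r where "a = j + r * f" "j \<in> ?J" by blast
    then show "s * a \<in> {j + r * f |j r. j \<in> ?J}"
      by (intro CollectI exI[of _ "s * j"] exI[of _ "s * r"])
        (simp add: distrib_left mult.assoc ideal_type_mult[OF ideal_genideal_type])
  qed
  show ?thesis
    using b
  proof (induction rule: ideal_prod.induct)
    case (prod i j)
    obtain i' r where i: "i = i' + r * f" "i' \<in> ?J" using prod(1) gen by blast
    have "i' * j \<in> ideal_prod ?R ?J I"
      using ideal_prod.prod[OF i(2) prod(2), of ?R] by (simp add: ring_of_type_algebra_def)
    then show ?case
      by (intro bexI[of _ "r * j"] ideal_type_mult[OF I] prod(2))
        (simp add: i(1) ring_of_type_algebra_def algebra_simps)
  next
    case (sum s1 s2)
    then obtain a1 a2 where a: "a1 \<in> I" "a2 \<in> I" "s1 - f * a1 \<in> ideal_prod ?R ?J I"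
      "s2 - f * a2 \<in> ideal_prod ?R ?J I" by blast
    have "(s1 \<oplus>\<^bsub>?R\<^esub> s2) - f * (a1 + a2) = (s1 - f * a1) + (s2 - f * a2)"
      by (simp add: ring_of_type_algebra_def algebra_simps)
    then show ?case
      using ideal_type_add[OF P a(3,4)] ideal_type_add[OF I a(1,2)]
      by (intro bexI[of _ "a1 + a2"]) simp_all
  qed
qed

text \<open>
  One half of the depth sensitivity of the Koszul complex, which suffices to bound the length of
  regular sequences from above.
\<close>

theorem regular_sequence_koszul_vanishing:
  fixes x :: "'v::finite \<Rightarrow> 'a::comm_ring_1"
  assumes inj: "inj idx" and I: "ideal I ring_of_type_algebra"
    and reg: "regular_sequence_on ring_of_type_algebra I fs"
    and fs: "\<And>f. f \<in> set fs \<Longrightarrow> \<exists>g. f = (\<Sum>v\<in>UNIV. g v * x v)"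
    and c: "\<And>W. c W \<in> I" "\<And>W. length fs \<le> card W \<Longrightarrow> c W = 0" "\<And>W. koszul_d idx x c W = 0"
  shows "\<exists>w. (\<forall>W. w W \<in> I) \<and> (\<forall>W. c W = koszul_d idx x w W)"
proof -
  let ?R = "ring_of_type_algebra :: 'a ring"
  define Q where "Q k = ideal_prod ?R (genideal ?R (set (take k fs))) I" for k
  have Q: "ideal (Q k) ?R" for k
    unfolding Q_def
    by (intro ring.ideal_prod_is_ideal[OF ring_from_type_algebra] ideal_genideal_type I)
  have gen_mono: "genideal ?R (set (take k fs)) \<subseteq> genideal ?R (set (take (Suc k) fs))" for k
    using set_take_subset_set_take[of k "Suc k" fs]
    by (intro genideal_type_subset[OF ideal_genideal_type] order.trans[OF _ subset_genideal_type]) simp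
  have split: "\<exists>a\<in>I. b - fs ! k * a \<in> Q k" if "k < length fs" "b \<in> Q (Suc k)" for k b
    using ideal_prod_genideal_insert[OF I, of b "fs ! k" "set (take k fs)"] that
    by (simp add: Q_def take_Suc_conv_app_nth)
  have "\<exists>w. (\<forall>W. w W \<in> I) \<and> (\<forall>W. length fs \<le> Suc (card W) \<longrightarrow> w W = 0) \<and>
    (\<forall>W. c W - koszul_d idx x w W \<in> Q 0)"
  proof (rule koszul_vanishing_filtration[where d = "length fs" and f = "\<lambda>k. fs ! k" and Q = Q,
        OF inj I Q])
    show "Q k \<subseteq> I" for k
      using ring.ideal_prod_inter[OF ring_from_type_algebra ideal_genideal_type I]
      unfolding Q_def by blast
    show "Q k \<subseteq> Q (Suc k)" for k
    proof
      fix b assume "b \<in> Q k"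
      then show "b \<in> Q (Suc k)" unfolding Q_def
        by (induction rule: ideal_prod.induct) (use gen_mono in \<open>auto intro: ideal_prod.intros\<close>)
    qed
    show "fs ! k * a \<in> Q (Suc k)" if "k < length fs" "a \<in> I" for k a
    proof -
      have "fs ! k \<in> set (take (Suc k) fs)" using that by (simp add: take_Suc_conv_app_nth)
      then have "fs ! k \<in> genideal ?R (set (take (Suc k) fs))" using subset_genideal_type by blast
      then show ?thesis
        using ideal_prod.prod[OF _ that(2), of "fs ! k" _ ?R]
        by (simp add: Q_def ring_of_type_algebra_def)
    qed
    show "a \<in> Q k" if "k < length fs" "a \<in> I" "fs ! k * a \<in> Q k" for k a
    proof -
      have "(fs ! k) \<otimes>\<^bsub>?R\<^esub> a = fs ! k * a" by (simp add: ring_of_type_algebra_def)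
      then show ?thesis
        using reg that by (simp add: Q_def regular_sequence_on_def)
    qed
    show "koszul_d idx x c W \<in> Q 0" for W
      using c(3) ideal_type_zero[OF Q] by simp
  qed (use split fs c in auto)
  then obtain w where w: "\<And>W. w W \<in> I" "\<And>W. c W - koszul_d idx x w W \<in> Q 0" by blast
  have "Q 0 \<subseteq> {0}"
  proof
    have gen0: "genideal ?R {} \<subseteq> {0}" by (rule genideal_type_subset[OF ideal_typeI]) auto
    fix b assume "b \<in> Q 0"
    then show "b \<in> {0}" unfolding Q_def
    proof (induction rule: ideal_prod.induct)
      case (prod i j)
      then have "i = 0" using gen0 by auto
      then show ?case by (simp add: ring_of_type_algebra_def)
    qed (simp add: ring_of_type_algebra_def)
  qed
  then show ?thesis using w by (metis eq_iff_diff_eq_0 singletonD subsetD)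
qed


section \<open>Polynomials and squarefree monomial ideals\<close>

lemma keys_add_nat: "Poly_Mapping.keys (u + w) = Poly_Mapping.keys u \<union> Poly_Mapping.keys w"
  for u w :: "'v \<Rightarrow>\<^sub>0 nat"
  by (auto simp: in_keys_iff lookup_add)

lemma poly_sum_single: "(\<Sum>u\<in>Poly_Mapping.keys f. Poly_Mapping.single u (Poly_Mapping.lookup f u)) = f"
proof (rule poly_mapping_eqI)
  fix k
  have "Poly_Mapping.lookup (\<Sum>u\<in>Poly_Mapping.keys f. Poly_Mapping.single u (Poly_Mapping.lookup f u)) k =
    (\<Sum>u\<in>Poly_Mapping.keys f. if u = k then Poly_Mapping.lookup f u else 0)"
    by (auto simp: lookup_sum lookup_single when_def intro!: sum.cong)
  then show "Poly_Mapping.lookup (\<Sum>u\<in>Poly_Mapping.keys f. Poly_Mapping.single u (Poly_Mapping.lookup f u)) k =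
    Poly_Mapping.lookup f k"
    by (simp add: in_keys_iff)
qed

lemma lookup_mult_keys:
  fixes f g :: "('v, 'k::field) mpoly"
  shows "Poly_Mapping.lookup (f * g) k =
    (\<Sum>u\<in>Poly_Mapping.keys f. \<Sum>w\<in>Poly_Mapping.keys g.
      if u + w = k then Poly_Mapping.lookup f u * Poly_Mapping.lookup g w else 0)"
proof -
  have "f * g = (\<Sum>u\<in>Poly_Mapping.keys f. Poly_Mapping.single u (Poly_Mapping.lookup f u)) *
      (\<Sum>w\<in>Poly_Mapping.keys g. Poly_Mapping.single w (Poly_Mapping.lookup g w))"
    by (simp add: poly_sum_single)
  also have "\<dots> = (\<Sum>u\<in>Poly_Mapping.keys f. \<Sum>w\<in>Poly_Mapping.keys g.
      Poly_Mapping.single (u + w) (Poly_Mapping.lookup f u * Poly_Mapping.lookup g w))"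
    by (simp add: sum_product mult_single)
  finally show ?thesis
    by (auto simp: lookup_sum lookup_single when_def intro!: sum.cong)
qed

lemma keys_monomial [simp]: "Poly_Mapping.keys (monomial w :: ('v, 'k::field) mpoly) = {w}"
  by (simp add: monomial_def)

lemma lookup_monomial: "Poly_Mapping.lookup (monomial w :: ('v, 'k::field) mpoly) u = (if u = w then 1 else 0)"
  by (simp add: monomial_def lookup_single when_def)

lemma monomial_mult: "monomial u * monomial w = (monomial (u + w) :: ('v, 'k::field) mpoly)"
  by (simp add: monomial_def mult_single)

lemma lookup_monomial_mult:
  fixes f :: "('v, 'k::field) mpoly"
  shows "Poly_Mapping.lookup (monomial w * f) (w + u) = Poly_Mapping.lookup f u"
proof -
  have "Poly_Mapping.lookup (monomial w * f) (w + u) =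
      (\<Sum>u'\<in>Poly_Mapping.keys f. if u' = u then Poly_Mapping.lookup f u' else 0)"
    by (simp add: lookup_mult_keys lookup_monomial)
  then show ?thesis by (simp add: in_keys_iff)
qed

lemma keys_monomial_mult:
  fixes f :: "('v, 'k::field) mpoly"
  shows "Poly_Mapping.keys (monomial w * f) = (+) w ` Poly_Mapping.keys f"
proof
  show "Poly_Mapping.keys (monomial w * f) \<subseteq> (+) w ` Poly_Mapping.keys f"
    using keys_mult[of "monomial w" f] by auto
  show "(+) w ` Poly_Mapping.keys f \<subseteq> Poly_Mapping.keys (monomial w * f)"
    by (auto simp: in_keys_iff lookup_monomial_mult)
qed

lemma lookup_sign_mult:
  fixes p :: "('v, 'k::field) mpoly"
  shows "Poly_Mapping.lookup (koszul_sign idx v W * p) u = koszul_sign idx v W * Poly_Mapping.lookup p u"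
proof -
  have "Poly_Mapping.lookup ((-1) ^ n * p) u = (-1) ^ n * Poly_Mapping.lookup p u" for n
    by (induction n) simp_all
  then show ?thesis by (simp add: koszul_sign_def)
qed

definition squarefree_exponent :: "'v::finite set \<Rightarrow> 'v \<Rightarrow>\<^sub>0 nat"
  where "squarefree_exponent T = (\<Sum>v\<in>T. Poly_Mapping.single v 1)"

lemma lookup_squarefree_exponent:
  "Poly_Mapping.lookup (squarefree_exponent T) v = (if v \<in> T then 1 else 0)"
  by (simp add: squarefree_exponent_def lookup_sum lookup_single when_def)

lemma keys_squarefree_exponent [simp]: "Poly_Mapping.keys (squarefree_exponent T) = T"
  by (auto simp: in_keys_iff lookup_squarefree_exponent split: if_splits)

lemma squarefree_exponent_insert:
  "v \<notin> T \<Longrightarrow> squarefree_exponent (insert v T) = Poly_Mapping.single v 1 + squarefree_exponent T"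
  by (simp add: squarefree_exponent_def)

lemma var_mult_squarefree_monomial:
  "v \<in> T \<Longrightarrow> var v * monomial (squarefree_exponent (T - {v})) =
    (monomial (squarefree_exponent T) :: ('v::finite, 'k::field) mpoly)"
  using squarefree_exponent_insert[of v "T - {v}"]
  by (simp add: var_def monomial_mult insert_absorb)

lemma lookup_var_mult_squarefree:
  fixes p :: "('v::finite, 'k::field) mpoly"
  shows "Poly_Mapping.lookup (var v * p) (squarefree_exponent T) =
    (if v \<in> T then Poly_Mapping.lookup p (squarefree_exponent (T - {v})) else 0)"
proof (cases "v \<in> T")
  case True
  then have "squarefree_exponent T = Poly_Mapping.single v 1 + squarefree_exponent (T - {v})"
    using squarefree_exponent_insert[of v "T - {v}"] by (simp add: insert_absorb)
  then show ?thesis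
    using True by (simp add: var_def lookup_monomial_mult)
next
  case False
  have "squarefree_exponent T \<notin> Poly_Mapping.keys (var v * p)"
  proof
    assume "squarefree_exponent T \<in> Poly_Mapping.keys (var v * p)"
    then obtain u where "squarefree_exponent T = Poly_Mapping.single v 1 + u"
      by (auto simp: var_def keys_monomial_mult)
    then have "v \<in> T"
      using keys_add_nat[of "Poly_Mapping.single v 1" u] keys_squarefree_exponent[of T] by auto
    then show False using False by simp
  qed
  then show ?thesis using False by (simp add: in_keys_iff)
qed

definition upward_closed :: "'v set set \<Rightarrow> bool"
  where "upward_closed N \<longleftrightarrow> (\<forall>A B. A \<in> N \<longrightarrow> A \<subseteq> B \<longrightarrow> B \<in> N)"

lemma upward_closedD: "upward_closed N \<Longrightarrow> A \<in> N \<Longrightarrow> A \<subseteq> B \<Longrightarrow> B \<in> N"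
  by (auto simp: upward_closed_def)

definition support_ideal :: "'v set set \<Rightarrow> ('v, 'k::field) mpoly set"
  where "support_ideal N = {f. \<forall>u\<in>Poly_Mapping.keys f. Poly_Mapping.keys u \<in> N}"

lemma monomial_in_support_ideal_iff:
  "(monomial u :: ('v, 'k::field) mpoly) \<in> support_ideal N \<longleftrightarrow> Poly_Mapping.keys u \<in> N"
  by (simp add: support_ideal_def)

lemma ideal_support_ideal:
  assumes "upward_closed N"
  shows "ideal (support_ideal N :: ('v, 'k::field) mpoly set) mpoly_ring"
proof (rule ideal_typeI)
  fix r a :: "('v, 'k) mpoly" assume a: "a \<in> support_ideal N"
  have "Poly_Mapping.keys k \<in> N" if key: "k \<in> Poly_Mapping.keys (r * a)" for k
  proof -
    obtain u w where k: "k = u + w" "w \<in> Poly_Mapping.keys a"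
      using subsetD[OF keys_mult key] by blast
    have "Poly_Mapping.keys w \<in> N" using a k(2) by (simp add: support_ideal_def)
    then show ?thesis
      using upward_closedD[OF assms] unfolding k(1) keys_add_nat by blast
  qed
  then show "r * a \<in> support_ideal N" by (simp add: support_ideal_def)
next
  fix a b :: "('v, 'k) mpoly" assume "a \<in> support_ideal N" "b \<in> support_ideal N"
  then show "a + b \<in> support_ideal N"
    using Poly_Mapping.keys_add[of a b] by (auto simp: support_ideal_def)
qed (simp add: support_ideal_def)

text \<open>
  Divisibility by a squarefree monomial only depends on the support, so the ideal is determined by an
  upward closed family of sets of variables: the nonfaces of its simplicial complex.
\<close>

lemma squarefree_monomial_ideal_support:
  fixes I :: "('v::finite, 'k::field) mpoly set"
  assumes "squarefree_monomial_ideal I"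
  obtains N where "upward_closed N" "I = support_ideal N"
proof -
  obtain A :: "('v \<Rightarrow>\<^sub>0 nat) set" where A: "\<And>u v. u \<in> A \<Longrightarrow> Poly_Mapping.lookup u v \<le> 1"
    and I: "I = genideal mpoly_ring (monomial ` A)"
    using assms by (auto simp: squarefree_monomial_ideal_def)
  define N where "N = {T. \<exists>u\<in>A. Poly_Mapping.keys u \<subseteq> T}"
  have up: "upward_closed N" by (auto simp: upward_closed_def N_def)
  have "I \<subseteq> support_ideal N"
    unfolding I
    by (rule genideal_type_subset[OF ideal_support_ideal[OF up]])
      (auto simp: monomial_in_support_ideal_iff N_def)
  moreover have "support_ideal N \<subseteq> I"
  proof
    fix f :: "('v, 'k) mpoly" assume f: "f \<in> support_ideal N"
    have "(\<Sum>k\<in>Poly_Mapping.keys f. Poly_Mapping.single k (Poly_Mapping.lookup f k)) \<in> I"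
      unfolding I
    proof (rule ideal_type_sum[OF ideal_genideal_type])
      fix k assume "k \<in> Poly_Mapping.keys f"
      then obtain u where u: "u \<in> A" "Poly_Mapping.keys u \<subseteq> Poly_Mapping.keys k"
        using f by (auto simp: support_ideal_def N_def)
      have "Poly_Mapping.lookup u v \<le> Poly_Mapping.lookup k v" for v
      proof (cases "v \<in> Poly_Mapping.keys u")
        case True
        then have "Poly_Mapping.lookup k v \<noteq> 0" using u(2) unfolding in_keys_iff[symmetric] by blast
        then show ?thesis using A[OF u(1), of v] by linarith
      qed (simp add: in_keys_iff)
      then have k: "k = (k - u) + u"
        by (intro poly_mapping_eqI) (simp add: lookup_add lookup_minus)
      have eq: "Poly_Mapping.single k (Poly_Mapping.lookup f k) =
          Poly_Mapping.single (k - u) (Poly_Mapping.lookup f k) * monomial u"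
        using k by (metis monomial_def mult_single mult_1_right)
      have mem: "monomial u \<in> genideal mpoly_ring (monomial ` A :: ('v, 'k) mpoly set)"
        by (rule subsetD[OF subset_genideal_type imageI[OF u(1)]])
      show "Poly_Mapping.single k (Poly_Mapping.lookup f k) \<in> genideal mpoly_ring (monomial ` A)"
        unfolding eq by (rule ideal_type_mult[OF ideal_genideal_type mem])
    qed
    then show "f \<in> I" by (simp add: poly_sum_single)
  qed
  ultimately show ?thesis using that up by blast
qed

lemma max_ideal_combination:
  fixes f :: "('v::finite, 'k::field) mpoly"
  assumes "f \<in> max_ideal"
  shows "\<exists>g. f = (\<Sum>v\<in>UNIV. g v * var v)"
proof -
  let ?M = "{f. \<exists>g. f = (\<Sum>v\<in>UNIV. g v * (var v :: ('v, 'k) mpoly))}"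
  have "max_ideal \<subseteq> ?M"
    unfolding max_ideal_def
  proof (rule genideal_type_subset[OF ideal_typeI])
    show "0 \<in> ?M" by (intro CollectI exI[of _ "\<lambda>_. 0"]) simp
    show "range var \<subseteq> ?M"
    proof safe
      fix w :: 'v
      have "var w = (\<Sum>v\<in>UNIV. (if v = w then 1 else 0) * (var v :: ('v, 'k) mpoly))"
        by (subst sum.mono_neutral_right[of UNIV "{w}"]) auto
      then show "\<exists>g. var w = (\<Sum>v\<in>UNIV. g v * (var v :: ('v, 'k) mpoly))"
        by (rule exI[of _ "\<lambda>v. if v = w then 1 else 0"])
    qed
  next
    fix a b assume "a \<in> ?M" "b \<in> ?M"
    then obtain g h where "a = (\<Sum>v\<in>UNIV. g v * var v)" "b = (\<Sum>v\<in>UNIV. h v * var v)" by blast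
    then show "a + b \<in> ?M"
      by (intro CollectI exI[of _ "\<lambda>v. g v + h v"]) (simp add: distrib_right sum.distrib)
  next
    fix r a assume "a \<in> ?M"
    then obtain g where "a = (\<Sum>v\<in>UNIV. g v * var v)" by blast
    then show "r * a \<in> ?M"
      by (intro CollectI exI[of _ "\<lambda>v. r * g v"]) (simp add: sum_distrib_left mult.assoc)
  qed
  then show ?thesis using assms by blast
qed


section \<open>Bounding the length of regular sequences\<close>

text \<open>
  The labelling \<open>blk\<close> sorts the variables into the blocks \<open>0, \<dots>, j - 1\<close> and a remainder with labels at
  least \<open>j\<close>; a transversal picks one variable from each block and none from the remainder.
\<close>

definition transversal :: "('v \<Rightarrow> nat) \<Rightarrow> nat \<Rightarrow> 'v set \<Rightarrow> bool"
  where "transversal blk j T \<longleftrightarrow> (\<forall>v\<in>T. blk v < j) \<and> (\<forall>i<j. \<exists>!v. v \<in> T \<and> blk v = i)"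

lemma card_transversal:
  assumes "transversal blk j T"
  shows "card T = j"
proof -
  have "bij_betw blk T {..<j}"
    using assms unfolding transversal_def bij_betw_def inj_on_def by (auto simp: image_iff)
  then show ?thesis using bij_betw_same_card by fastforce
qed

text \<open>
  The cochain is, up to sign, the wedge product of \<open>e\<^sub>N\<close> with the elements \<open>d\<^sub>i = \<Sum> x\<^sub>v e\<^sub>v\<close> taken over the
  blocks. As \<open>d\<^sub>i \<and> d\<^sub>i = 0\<close>, it is annihilated by all \<open>d\<^sub>i\<close>, and the variables in \<open>N\<close> are already used
  up by \<open>e\<^sub>N\<close>. The assumption that \<open>idx\<close> lists the blocks in order makes all signs of the
  cochain equal. If its differential has a nonzero term at \<open>W\<close>, then \<open>W\<close> contains exactly two variables of
  one block, either of which can be removed; no element of \<open>W\<close> lies between them, so that the two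
  contributions cancel.
\<close>

lemma transversal_cochain_cocycle:
  fixes idx blk :: "'v::finite \<Rightarrow> nat" and j :: nat
  assumes inj: "inj idx" and mono: "\<And>u v. blk u < blk v \<Longrightarrow> idx u < idx v"
  defines "N \<equiv> {v. j \<le> blk v}"
  defines "c \<equiv> \<lambda>W. if N \<subseteq> W \<and> transversal blk j (W - N)
    then monomial (squarefree_exponent (W - N)) else (0 :: ('v, 'k::field) mpoly)"
  shows "koszul_d idx var c W = 0"
proof (cases "\<exists>v\<in>W. N \<subseteq> W - {v} \<and> transversal blk j (W - {v} - N)")
  case False
  then show ?thesis unfolding koszul_d_def by (intro sum.neutral ballI) (auto simp: c_def)
next
  case True
  then obtain v1 where v1: "v1 \<in> W" "N \<subseteq> W - {v1}" "transversal blk j (W - {v1} - N)" by blast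
  define T where "T = W - N"
  have v1N: "v1 \<notin> N" using v1 by blast
  have v1j: "blk v1 < j" using v1N by (simp add: N_def)
  have T1: "transversal blk j (T - {v1})"
  proof -
    have "W - {v1} - N = T - {v1}" by (auto simp: T_def)
    then show ?thesis using v1(3) by simp
  qed
  have "\<exists>!v. v \<in> T - {v1} \<and> blk v = blk v1"
    using T1 v1j by (auto simp only: transversal_def)
  then have "\<exists>v2. (v2 \<in> T - {v1} \<and> blk v2 = blk v1) \<and>
      (\<forall>v. v \<in> T - {v1} \<and> blk v = blk v1 \<longrightarrow> v = v2)"
    unfolding Ex1_def .
  then obtain v2 where v2': "(v2 \<in> T - {v1} \<and> blk v2 = blk v1) \<and>
      (\<forall>v. v \<in> T - {v1} \<and> blk v = blk v1 \<longrightarrow> v = v2)"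
    by (rule exE)
  have v2: "v2 \<in> T - {v1}" "blk v2 = blk v1"
    using v2' by (auto simp only:)
  have v2_unique: "v = v2" if "v \<in> T - {v1}" "blk v = blk v1" for v
    using v2' that by (elim conjE allE[of _ v] impE) (intro conjI)
  have v1T: "v1 \<in> T" using v1 v1N by (simp add: T_def)
  have v2N: "v2 \<in> W" "v2 \<notin> N" "v1 \<noteq> v2" using v2 by (auto simp: T_def)
  have T2: "transversal blk j (T - {v2})"
    unfolding transversal_def
  proof (intro conjI allI impI ballI)
    show "blk v < j" if "v \<in> T - {v2}" for v
      using that T1 v1j unfolding transversal_def by (cases "v = v1") auto
    fix i assume i: "i < j"
    show "\<exists>!v. v \<in> T - {v2} \<and> blk v = i"
    proof (cases "i = blk v1")
      case True
      then show ?thesis using v1T v2N v2_unique by (intro ex1I[of _ v1]) blast+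
    next
      case False
      have "(v \<in> T - {v2} \<and> blk v = i) \<longleftrightarrow> (v \<in> T - {v1} \<and> blk v = i)" for v
        using False v2 by auto
      then show ?thesis using T1 i unfolding transversal_def by simp
    qed
  qed
  have only: "c (W - {v}) = 0" if "v \<in> W - {v1, v2}" for v
  proof -
    have "\<not> transversal blk j (W - {v} - N)"
    proof
      assume "transversal blk j (W - {v} - N)"
      moreover have "v1 \<in> W - {v} - N" "v2 \<in> W - {v} - N" using that v1 v1N v2N by auto
      ultimately show False using v2(2) v2N(3) v1j unfolding transversal_def by metis
    qed
    then show ?thesis by (simp add: c_def)
  qed
  have cv: "var v * c (W - {v}) = monomial (squarefree_exponent T)" if "v \<in> {v1, v2}" for v
  proof -
    have "W - {v} - N = T - {v}" by (auto simp: T_def)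
    moreover have "N \<subseteq> W - {v}" using that v1 v2N by auto
    moreover have "v \<in> T" using that v1T v2 by auto
    ultimately show ?thesis
      using that T1 T2 by (auto simp: c_def var_mult_squarefree_monomial)
  qed
  have sgn: "koszul_sign idx v1 W = - (koszul_sign idx v2 W :: ('v, 'k) mpoly)"
  proof -
    define B where "B = W - {v1, v2}"
    have W: "W = insert v1 (insert v2 B)" "v1 \<notin> B" "v2 \<notin> B" using v1 v2N by (auto simp: B_def)
    have "{u \<in> B. idx u < idx v1} = {u \<in> B. idx u < idx v2}"
    proof -
      have ne: "blk u \<noteq> blk v1" if "u \<in> B" for u
        using that v2_unique[of u] v1j by (auto simp: B_def T_def N_def)
      have "idx u < idx v \<longleftrightarrow> blk u < blk v" if "blk u \<noteq> blk v" for u v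
        using mono[of u v] mono[of v u] that by fastforce
      then show ?thesis using ne v2(2) by force
    qed
    then have "koszul_sign idx v1 B = (koszul_sign idx v2 B :: ('v, 'k) mpoly)"
      by (simp add: koszul_sign_def)
    moreover have "idx v1 < idx v2 \<or> idx v2 < idx v1" using inj v2N(3) by (metis injD linorder_neqE_nat)
    ultimately show ?thesis
      using W v2N(3) by (auto simp: koszul_sign_insert)
  qed
  have "koszul_d idx var c W = (\<Sum>v\<in>{v1, v2}. koszul_sign idx v W * var v * c (W - {v}))"
    unfolding koszul_d_def using v1(1) v2N(1) only by (intro sum.mono_neutral_right) auto
  also have "\<dots> = (\<Sum>v\<in>{v1, v2}. koszul_sign idx v W * monomial (squarefree_exponent T))"
    by (intro sum.cong refl) (simp add: mult.assoc cv)
  also have "\<dots> = 0" using v2N(3) by (simp add: sgn)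
  finally show ?thesis .
qed

text \<open>
  Suppose that the cochain of the previous lemma is the coboundary of some \<open>w\<close> with values in the ideal.
  Only the part of \<open>w\<close> in one multidegree matters: \<open>\<omega>(T)\<close> is the coefficient of \<open>x\<^sup>T\<close> in \<open>w(N \<union> T)\<close>. It
  vanishes on faces, because \<open>x\<^sup>T\<close> is then not in the ideal, and the equation \<open>c = dw\<close> becomes the
  simplicial coboundary equation outside \<open>N\<close>. So a regular sequence that is too long produces a function
  \<open>\<omega>\<close>, whose existence the following bounds refute or exploit.
\<close>

lemma regular_sequence_coefficients:
  fixes idx blk :: "'v::finite \<Rightarrow> nat" and fs :: "('v, 'k::field) mpoly list"
  assumes inj: "inj idx" and mono: "\<And>u v. blk u < blk v \<Longrightarrow> idx u < idx v"
    and up: "upward_closed NF"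
    and reg: "regular_sequence_on mpoly_ring (support_ideal NF) fs" and fs: "set fs \<subseteq> max_ideal"
    and nonfaces: "\<And>T. transversal blk j T \<Longrightarrow> T \<in> NF"
    and long: "card {v. j \<le> blk v} + j < length fs"
  shows "\<exists>\<omega> :: 'v set \<Rightarrow> 'k. (\<forall>T. T \<notin> NF \<longrightarrow> \<omega> T = 0) \<and>
    (\<forall>T. (\<forall>v\<in>T. blk v < j) \<longrightarrow>
      (\<Sum>v\<in>T. koszul_sign idx v T * \<omega> (T - {v})) = (if transversal blk j T then 1 else 0))"
proof -
  define N where "N = {v. j \<le> blk v}"
  define c where "c = (\<lambda>W. if N \<subseteq> W \<and> transversal blk j (W - N)
    then monomial (squarefree_exponent (W - N)) else (0 :: ('v, 'k) mpoly))"
  have "\<exists>w. (\<forall>W. w W \<in> support_ideal NF) \<and> (\<forall>W. c W = koszul_d idx var w W)"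
  proof (rule regular_sequence_koszul_vanishing[OF inj ideal_support_ideal[OF up] reg])
    show "\<exists>g. f = (\<Sum>v\<in>UNIV. g v * var v)" if "f \<in> set fs" for f
      using that fs max_ideal_combination by blast
    show "c W \<in> support_ideal NF" for W
      by (simp add: c_def monomial_in_support_ideal_iff nonfaces
          ideal_type_zero[OF ideal_support_ideal[OF up]])
    show "c W = 0" if "length fs \<le> card W" for W
    proof -
      have "card W = card N + j" if "N \<subseteq> W" "transversal blk j (W - N)"
        using card_transversal[OF that(2)] that(1) card_mono[of W N] by (simp add: card_Diff_subset)
      then show ?thesis using that long by (auto simp: c_def N_def)
    qed
    show "koszul_d idx var c W = 0" for W
      unfolding c_def N_def by (rule transversal_cochain_cocycle[OF inj mono])
  qed
  then obtain w where w: "\<And>W. w W \<in> support_ideal NF" "\<And>W. c W = koszul_d idx var w W" by blast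
  define \<omega> where "\<omega> T = Poly_Mapping.lookup (w (N \<union> T)) (squarefree_exponent T)" for T
  show ?thesis
  proof (intro exI[of _ \<omega>] conjI allI impI)
    show "\<omega> T = 0" if "T \<notin> NF" for T
    proof -
      have "squarefree_exponent T \<notin> Poly_Mapping.keys (w (N \<union> T))"
        using w(1)[of "N \<union> T"] that by (auto simp: support_ideal_def)
      then show ?thesis by (simp add: \<omega>_def in_keys_iff)
    qed
  next
    fix T assume "\<forall>v\<in>T. blk v < j"
    then have T: "blk v < j" if "v \<in> T" for v using that by blast
    have TN: "T \<inter> N = {}" using T by (force simp: N_def)
    have "(if transversal blk j T then 1 else 0) = Poly_Mapping.lookup (c (N \<union> T)) (squarefree_exponent T)"
    proof -
      have "N \<union> T - N = T" using TN by blast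
      then show ?thesis by (simp add: c_def lookup_monomial)
    qed
    also have "\<dots> = (\<Sum>v\<in>N \<union> T. koszul_sign idx v (N \<union> T) *
        (if v \<in> T then Poly_Mapping.lookup (w (N \<union> T - {v})) (squarefree_exponent (T - {v})) else 0))"
      by (simp add: w(2) koszul_d_def lookup_sum mult.assoc lookup_sign_mult lookup_var_mult_squarefree)
    also have "\<dots> = (\<Sum>v\<in>T. koszul_sign idx v T * \<omega> (T - {v}))"
    proof (rule sum.mono_neutral_cong_right)
      fix v assume v: "v \<in> T"
      have "{u \<in> N \<union> T. idx u < idx v} = {u \<in> T. idx u < idx v}"
      proof -
        have "\<not> idx u < idx v" if "u \<in> N" for u
          using mono[of v u] T[OF v] that by (simp add: N_def)
        then show ?thesis by blast
      qed
      moreover have "N \<union> T - {v} = N \<union> (T - {v})" using v TN by blast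
      ultimately show "koszul_sign idx v (N \<union> T) * (if v \<in> T then
          Poly_Mapping.lookup (w (N \<union> T - {v})) (squarefree_exponent (T - {v})) else 0) =
          koszul_sign idx v T * \<omega> (T - {v})"
        using v by (simp add: koszul_sign_def \<omega>_def)
    qed auto
    finally show "(\<Sum>v\<in>T. koszul_sign idx v T * \<omega> (T - {v})) = (if transversal blk j T then 1 else 0)"
      by simp
  qed
qed

lemma block_index_exists:
  fixes blk :: "'v::finite \<Rightarrow> nat"
  shows "\<exists>idx :: 'v \<Rightarrow> nat. inj idx \<and> (\<forall>u v. blk u < blk v \<longrightarrow> idx u < idx v)"
proof -
  obtain i :: "'v \<Rightarrow> nat" and n where i: "inj i" "range i = {k. k < n}"
    using finite_imp_inj_to_nat_seg[OF finite_UNIV] by blast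
  have lt: "i v < n" for v using i(2) by blast
  define idx where "idx v = blk v * n + i v" for v
  have less: "idx u < idx v" if "blk u < blk v" for u v
  proof -
    have "idx u < Suc (blk u) * n" using lt[of u] by (simp add: idx_def)
    also have "\<dots> \<le> blk v * n" using that by (intro mult_right_mono) auto
    finally show ?thesis by (simp add: idx_def)
  qed
  have "inj idx"
  proof (rule injI)
    fix u v assume e: "idx u = idx v"
    then have "blk u = blk v" using less[of u v] less[of v u] by (metis less_irrefl linorder_neqE_nat)
    then show "u = v" using e i(1) by (simp add: idx_def inj_eq)
  qed
  then show ?thesis using less by blast
qed

context
  fixes NF :: "'v::finite set set" and fs :: "('v, 'k::field) mpoly list"
  assumes up: "upward_closed NF"
    and reg: "regular_sequence_on mpoly_ring (support_ideal NF) fs" and fs: "set fs \<subseteq> max_ideal"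
begin

lemma regular_sequence_length_le_card:
  assumes "{} \<in> NF"
  shows "length fs \<le> card (UNIV :: 'v set)"
proof (rule ccontr)
  assume long: "\<not> ?thesis"
  define blk :: "'v \<Rightarrow> nat" where "blk v = 0" for v
  obtain idx :: "'v \<Rightarrow> nat" where idx': "inj idx" "\<forall>u v. blk u < blk v \<longrightarrow> idx u < idx v"
    using block_index_exists[of blk] by blast
  note idx = idx'(1) idx'(2)[rule_format]
  have tr: "transversal blk 0 T \<longleftrightarrow> T = {}" for T
    by (auto simp: transversal_def)
  have "\<exists>\<omega> :: 'v set \<Rightarrow> 'k. (\<forall>T. T \<notin> NF \<longrightarrow> \<omega> T = 0) \<and>
      (\<forall>T. (\<forall>v\<in>T. blk v < 0) \<longrightarrow>
        (\<Sum>v\<in>T. koszul_sign idx v T * \<omega> (T - {v})) = (if transversal blk 0 T then 1 else 0))"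
    by (rule regular_sequence_coefficients[OF idx up reg fs]) (use assms tr long in auto)
  then obtain \<omega> :: "'v set \<Rightarrow> 'k" where \<omega>': "\<forall>T. T \<notin> NF \<longrightarrow> \<omega> T = 0"
    "\<forall>T. (\<forall>v\<in>T. blk v < 0) \<longrightarrow>
      (\<Sum>v\<in>T. koszul_sign idx v T * \<omega> (T - {v})) = (if transversal blk 0 T then 1 else 0)"
    by blast
  note \<omega> = \<omega>'(1)[rule_format] \<omega>'(2)[THEN spec, THEN mp]
  show False using \<omega>(2)[of "{}"] by (simp add: tr)
qed

text \<open>
  The variables outside \<open>C\<close> lie in the ideal. With these as the only block, \<open>\<omega>\<close> would take the value 1
  at the empty face. This settles complexes that consist of a single simplex on \<open>C\<close>.
\<close>

lemma regular_sequence_length_le_facet: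
  assumes "{} \<notin> NF" "\<And>v. v \<notin> C \<Longrightarrow> {v} \<in> NF" "C \<noteq> UNIV"
  shows "length fs \<le> card C + 1"
proof (rule ccontr)
  assume long: "\<not> ?thesis"
  define blk :: "'v \<Rightarrow> nat" where "blk v = (if v \<in> C then 1 else 0)" for v
  obtain idx :: "'v \<Rightarrow> nat" where idx': "inj idx" "\<forall>u v. blk u < blk v \<longrightarrow> idx u < idx v"
    using block_index_exists[of blk] by blast
  note idx = idx'(1) idx'(2)[rule_format]
  have tr: "transversal blk 1 T \<longleftrightarrow> (\<exists>v. v \<notin> C \<and> T = {v})" for T
    by (auto simp: transversal_def blk_def split: if_splits)
  have nf: "T \<in> NF" if "transversal blk 1 T" for T
    using that assms(2) unfolding tr by blast
  have C1: "{v. 1 \<le> blk v} = C" by (auto simp: blk_def)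
  have "\<exists>\<omega> :: 'v set \<Rightarrow> 'k. (\<forall>T. T \<notin> NF \<longrightarrow> \<omega> T = 0) \<and>
      (\<forall>T. (\<forall>v\<in>T. blk v < 1) \<longrightarrow>
        (\<Sum>v\<in>T. koszul_sign idx v T * \<omega> (T - {v})) = (if transversal blk 1 T then 1 else 0))"
    by (rule regular_sequence_coefficients[OF idx up reg fs]) (use nf C1 long in auto)
  then obtain \<omega> :: "'v set \<Rightarrow> 'k" where \<omega>': "\<forall>T. T \<notin> NF \<longrightarrow> \<omega> T = 0"
    "\<forall>T. (\<forall>v\<in>T. blk v < 1) \<longrightarrow>
      (\<Sum>v\<in>T. koszul_sign idx v T * \<omega> (T - {v})) = (if transversal blk 1 T then 1 else 0)"
    by blast
  note \<omega> = \<omega>'(1)[rule_format] \<omega>'(2)[THEN spec, THEN mp]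
  obtain v where v: "v \<notin> C" using assms(3) by blast
  have "transversal blk 1 {v}" using v unfolding tr by blast
  then show False
    using \<omega>(2)[of "{v}"] \<omega>(1)[OF assms(1)] v by (simp add: blk_def)
qed

text \<open>
  No face outside \<open>N\<close> contains vertices from both sides, so the indicator function of \<open>A\<close> represents a
  nonzero class in the reduced cohomology of degree zero. Concretely, \<open>\<omega>\<close> vanishes at the vertices \<open>a\<close>
  and \<open>b\<close>, whereas its values there would have to differ by 1.
\<close>

lemma regular_sequence_length_le_cut:
  assumes A: "A \<inter> N = {}" and cross: "\<And>a b. a \<in> A \<Longrightarrow> b \<notin> A \<Longrightarrow> b \<notin> N \<Longrightarrow> {a, b} \<in> NF"
    and a: "a \<in> A" "{a} \<notin> NF" and b: "b \<notin> A" "b \<notin> N" "{b} \<notin> NF"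
  shows "length fs \<le> card N + 2"
proof (rule ccontr)
  assume long: "\<not> ?thesis"
  define blk :: "'v \<Rightarrow> nat" where "blk v = (if v \<in> N then 2 else if v \<in> A then 0 else 1)" for v
  obtain idx :: "'v \<Rightarrow> nat" where idx': "inj idx" "\<forall>u v. blk u < blk v \<longrightarrow> idx u < idx v"
    using block_index_exists[of blk] by blast
  note idx = idx'(1) idx'(2)[rule_format]
  have nf: "T \<in> NF" if "transversal blk 2 T" for T
  proof -
    have ex: "\<exists>v\<in>T. blk v = i" if "i < 2" for i
      using \<open>transversal blk 2 T\<close> that unfolding transversal_def by blast
    obtain u where u: "u \<in> T" "blk u = 0" using ex[of 0] by auto
    obtain w where w: "w \<in> T" "blk w = 1" using ex[of 1] by auto
    have "{u, w} \<in> NF" using u w by (intro cross) (auto simp: blk_def split: if_splits)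
    then show ?thesis using upward_closedD[OF up] u w by blast
  qed
  have N2: "{v. 2 \<le> blk v} = N" by (auto simp: blk_def)
  have "\<exists>\<omega> :: 'v set \<Rightarrow> 'k. (\<forall>T. T \<notin> NF \<longrightarrow> \<omega> T = 0) \<and>
      (\<forall>T. (\<forall>v\<in>T. blk v < 2) \<longrightarrow>
        (\<Sum>v\<in>T. koszul_sign idx v T * \<omega> (T - {v})) = (if transversal blk 2 T then 1 else 0))"
    by (rule regular_sequence_coefficients[OF idx up reg fs]) (use nf N2 long in auto)
  then obtain \<omega> :: "'v set \<Rightarrow> 'k" where \<omega>': "\<forall>T. T \<notin> NF \<longrightarrow> \<omega> T = 0"
    "\<forall>T. (\<forall>v\<in>T. blk v < 2) \<longrightarrow>
      (\<Sum>v\<in>T. koszul_sign idx v T * \<omega> (T - {v})) = (if transversal blk 2 T then 1 else 0)"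
    by blast
  note \<omega> = \<omega>'(1)[rule_format] \<omega>'(2)[THEN spec, THEN mp]
  have ba: "blk a = 0" "blk b = 1" using a b A by (auto simp: blk_def)
  have ab: "a \<noteq> b" using a b by blast
  have "transversal blk 2 {a, b}"
    unfolding transversal_def
  proof (intro conjI allI impI)
    show "\<forall>v\<in>{a, b}. blk v < 2" using ba by simp
    fix i :: nat assume "i < 2"
    then consider "i = 0" | "i = 1" by linarith
    then show "\<exists>!v. v \<in> {a, b} \<and> blk v = i"
      by cases (use ba in auto)
  qed
  then have "(\<Sum>v\<in>{a, b}. koszul_sign idx v {a, b} * \<omega> ({a, b} - {v})) = 1"
    using \<omega>(2)[of "{a, b}"] ba by simp
  moreover have "\<omega> ({a, b} - {v}) = 0" if "v \<in> {a, b}" for v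
  proof -
    have "{a, b} - {v} = {a} \<or> {a, b} - {v} = {b}" using that ab by auto
    then show ?thesis using \<omega>(1)[OF a(2)] \<omega>(1)[OF b(3)] by (elim disjE) simp_all
  qed
  ultimately show False by simp
qed

text \<open>
  The three blocks \<open>A\<close>, \<open>B\<close>, \<open>D\<close> represent a class in cohomology of degree one. If it is trivial, then
  the variables \<open>y \<in> D\<close> with \<open>\<omega>{a, y} = 0\<close> form a set \<open>Y\<close> that is closed under adjacency in \<open>D\<close>, by the
  coboundary equation at \<open>{a, x, y}\<close>. An edge from \<open>Y\<close> to a neighbour \<open>b \<in> B\<close> of \<open>a\<close> would close a
  cycle, and the coboundary equation at \<open>{a, b, x}\<close> would read \<open>0 = 1\<close>.
\<close>

lemma regular_sequence_separation:
  assumes disj: "A \<inter> B = {}" "A \<inter> D = {}" "B \<inter> D = {}" and N: "N = - (A \<union> B \<union> D)"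
    and nonfaces: "\<And>u v w. u \<in> A \<Longrightarrow> v \<in> B \<Longrightarrow> w \<in> D \<Longrightarrow> {u, v, w} \<in> NF"
    and a: "a \<in> A" and long: "card N + 3 < length fs"
  shows "\<exists>Y. Y \<subseteq> D \<and> (\<forall>y\<in>D. {a, y} \<notin> NF \<longrightarrow> y \<in> Y) \<and>
    (\<forall>x\<in>Y. \<forall>y\<in>D. {x, y} \<notin> NF \<longrightarrow> y \<in> Y) \<and>
    (\<forall>x\<in>Y. \<forall>b\<in>B. {a, b} \<notin> NF \<longrightarrow> {x, b} \<in> NF)"
proof -
  define blk :: "'v \<Rightarrow> nat"
    where "blk v = (if v \<in> A then 0 else if v \<in> B then 1 else if v \<in> D then 2 else 3)" for v
  obtain idx :: "'v \<Rightarrow> nat" where idx': "inj idx" "\<forall>u v. blk u < blk v \<longrightarrow> idx u < idx v"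
    using block_index_exists[of blk] by blast
  note idx = idx'(1) idx'(2)[rule_format]
  have nf: "T \<in> NF" if "transversal blk 3 T" for T
  proof -
    have ex: "\<exists>v\<in>T. blk v = i" if "i < 3" for i
      using \<open>transversal blk 3 T\<close> that unfolding transversal_def by blast
    obtain u where u: "u \<in> T" "blk u = 0" using ex[of 0] by auto
    obtain v where v: "v \<in> T" "blk v = 1" using ex[of 1] by auto
    obtain w where w: "w \<in> T" "blk w = 2" using ex[of 2] by auto
    have "{u, v, w} \<in> NF" using u v w by (intro nonfaces) (auto simp: blk_def split: if_splits)
    then show ?thesis using upward_closedD[OF up] u v w by blast
  qed
  have N3: "{v. 3 \<le> blk v} = N" by (auto simp: blk_def N)
  have "\<exists>\<omega> :: 'v set \<Rightarrow> 'k. (\<forall>T. T \<notin> NF \<longrightarrow> \<omega> T = 0) \<and>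
      (\<forall>T. (\<forall>v\<in>T. blk v < 3) \<longrightarrow>
        (\<Sum>v\<in>T. koszul_sign idx v T * \<omega> (T - {v})) = (if transversal blk 3 T then 1 else 0))"
    by (rule regular_sequence_coefficients[OF idx up reg fs]) (use nf N3 long in auto)
  then obtain \<omega> :: "'v set \<Rightarrow> 'k" where \<omega>': "\<forall>T. T \<notin> NF \<longrightarrow> \<omega> T = 0"
    "\<forall>T. (\<forall>v\<in>T. blk v < 3) \<longrightarrow>
      (\<Sum>v\<in>T. koszul_sign idx v T * \<omega> (T - {v})) = (if transversal blk 3 T then 1 else 0)"
    by blast
  note \<omega> = \<omega>'(1)[rule_format] \<omega>'(2)[THEN spec, THEN mp]
  have D2: "blk y = 2" if "y \<in> D" for y using that disj by (auto simp: blk_def)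
  have B1: "blk y = 1" if "y \<in> B" for y using that disj by (auto simp: blk_def)
  have a0: "blk a = 0" using a by (simp add: blk_def)
  \<comment> \<open>the coboundary equation, with the signs given by the order of the three variables\<close>
  have triple: "\<omega> {y, z} - \<omega> {a, z} + \<omega> {a, y} = (if transversal blk 3 {a, y, z} then 1 else 0)"
    if "idx a < idx y" "idx y < idx z" "blk y < 3" "blk z < 3" for y z
  proof -
    have ne: "a \<noteq> y" "a \<noteq> z" "y \<noteq> z" using that by auto
    have e: "{a, y, z} - {a} = {y, z}" "{a, y, z} - {y} = {a, z}" "{a, y, z} - {z} = {a, y}"
      using ne by auto
    have s: "{u \<in> {a, y, z}. idx u < idx a} = {}" "{u \<in> {a, y, z}. idx u < idx y} = {a}"
      "{u \<in> {a, y, z}. idx u < idx z} = {a, y}" using that by auto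
    have sum_triple: "(\<Sum>v\<in>{a, y, z}. h v) = h a + (h y + h z)" for h :: "'v \<Rightarrow> 'k"
      using ne by simp
    show ?thesis
      using \<omega>(2)[of "{a, y, z}"] ne that a0 unfolding koszul_sign_def
      unfolding sum_triple s e by (simp add: algebra_simps)
  qed
  define Y where "Y = {y \<in> D. \<omega> {a, y} = 0}"
  show ?thesis
  proof (intro exI[of _ Y] conjI ballI impI)
    show "Y \<subseteq> D" by (auto simp: Y_def)
    show "y \<in> Y" if "y \<in> D" "{a, y} \<notin> NF" for y
      using that \<omega>(1) by (simp add: Y_def)
  next
    fix x y assume xy: "x \<in> Y" "y \<in> D" "{x, y} \<notin> NF"
    have x: "x \<in> D" "\<omega> {a, x} = 0" using xy(1) by (auto simp: Y_def)
    have less: "idx a < idx x" "idx a < idx y"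
      using idx(2)[of a x] idx(2)[of a y] D2[OF x(1)] D2[OF xy(2)] a0 by auto
    have nt: "\<not> transversal blk 3 {a, x, y}" "\<not> transversal blk 3 {a, y, x}"
    proof -
      have no: "\<not> transversal blk 3 T" if "\<And>v. v \<in> T \<Longrightarrow> blk v \<noteq> 1" for T
      proof
        assume "transversal blk 3 T"
        then have "\<exists>!v. v \<in> T \<and> blk v = 1" by (simp add: transversal_def)
        then show False using that by blast
      qed
      show "\<not> transversal blk 3 {a, x, y}" "\<not> transversal blk 3 {a, y, x}"
        by (rule no; use a0 D2[OF x(1)] D2[OF xy(2)] in auto)+
    qed
    have w0: "\<omega> {x, y} = 0" "\<omega> {y, x} = 0" using \<omega>(1)[OF xy(3)] by (simp_all add: insert_commute)
    consider "x = y" | "idx x < idx y" | "idx y < idx x" using idx(1) by (metis injD linorder_neqE_nat)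
    then have "\<omega> {a, y} = 0"
    proof cases
      case 1 then show ?thesis using x by simp
    next
      case 2
      then show ?thesis using triple[OF less(1) 2] D2 x xy(2) nt w0 by simp
    next
      case 3
      then show ?thesis using triple[OF less(2) 3] D2 x xy(2) nt w0 by simp
    qed
    then show "y \<in> Y" using xy(2) by (simp add: Y_def)
  next
    fix x b assume xb: "x \<in> Y" "b \<in> B" "{a, b} \<notin> NF"
    have x: "x \<in> D" "\<omega> {a, x} = 0" using xb(1) by (auto simp: Y_def)
    have less: "idx a < idx b" "idx b < idx x"
      using idx(2)[of a b] idx(2)[of b x] D2[OF x(1)] B1[OF xb(2)] a0 by auto
    have "transversal blk 3 {a, b, x}"
      unfolding transversal_def
    proof (intro conjI allI impI)
      show "\<forall>v\<in>{a, b, x}. blk v < 3" using a0 B1[OF xb(2)] D2[OF x(1)] by auto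
      fix i :: nat assume "i < 3"
      then consider "i = 0" | "i = 1" | "i = 2" by linarith
      then show "\<exists>!v. v \<in> {a, b, x} \<and> blk v = i"
        by cases (use a0 B1[OF xb(2)] D2[OF x(1)] in auto)
    qed
    then have "\<omega> {b, x} = 1"
      using triple[OF less] D2[OF x(1)] B1[OF xb(2)] x(2) \<omega>(1)[OF xb(3)] by simp
    then show "{x, b} \<in> NF" using \<omega>(1)[of "{b, x}"] by (auto simp: insert_commute)
  qed
qed

end


section \<open>Interval partitions and Stanley decompositions\<close>

definition interval_partition :: "('a set \<times> 'a set) set \<Rightarrow> 'a set set \<Rightarrow> bool"
  where "interval_partition P \<S> \<longleftrightarrow>
    (\<Union>p\<in>P. {fst p..snd p}) = \<S> \<and> (\<forall>p\<in>P. fst p \<subseteq> snd p) \<and>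
    (\<forall>p\<in>P. \<forall>q\<in>P. p \<noteq> q \<longrightarrow> {fst p..snd p} \<inter> {fst q..snd q} = {})"

definition partitionable :: "nat \<Rightarrow> 'a set set \<Rightarrow> bool"
  where "partitionable t \<S> \<longleftrightarrow> (\<exists>P. interval_partition P \<S> \<and> (\<forall>p\<in>P. t \<le> card (snd p)))"

lemma partitionable_family:
  assumes "\<And>k. k \<in> K \<Longrightarrow> A k \<subseteq> B k" "\<And>k. k \<in> K \<Longrightarrow> t \<le> card (B k)"
    and "\<And>k l. k \<in> K \<Longrightarrow> l \<in> K \<Longrightarrow> k \<noteq> l \<Longrightarrow> {A k..B k} \<inter> {A l..B l} = {}"
    and "(\<Union>k\<in>K. {A k..B k}) = \<S>"
  shows "partitionable t \<S>"
  unfolding partitionable_def interval_partition_def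
proof (intro exI[of _ "(\<lambda>k. (A k, B k)) ` K"] conjI)
  show "\<forall>p\<in>(\<lambda>k. (A k, B k)) ` K. \<forall>q\<in>(\<lambda>k. (A k, B k)) ` K. p \<noteq> q \<longrightarrow>
    {fst p..snd p} \<inter> {fst q..snd q} = {}"
  proof clarsimp
    fix k l assume "k \<in> K" "l \<in> K" "A k = A l \<longrightarrow> B k \<noteq> B l"
    then show "{A k..B k} \<inter> {A l..B l} = {}"
      using assms(3)[of k l] by (cases "k = l") auto
  qed
qed (use assms in auto)

lemma partitionable_large:
  assumes "\<And>T. T \<in> \<S> \<Longrightarrow> t \<le> card T"
  shows "partitionable t \<S>"
  by (rule partitionable_family[of \<S> "\<lambda>T. T" "\<lambda>T. T"]) (use assms in auto)

lemma partitionable_union: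
  assumes "partitionable t \<S>" "partitionable t \<T>" "\<S> \<inter> \<T> = {}"
  shows "partitionable t (\<S> \<union> \<T>)"
proof -
  obtain P where P: "interval_partition P \<S>" "\<forall>p\<in>P. t \<le> card (snd p)"
    using assms(1) unfolding partitionable_def by blast
  obtain Q where Q: "interval_partition Q \<T>" "\<forall>p\<in>Q. t \<le> card (snd p)"
    using assms(2) unfolding partitionable_def by blast
  have PS: "{fst p..snd p} \<subseteq> \<S>" if "p \<in> P" for p
    using P(1) that unfolding interval_partition_def by blast
  have QT: "{fst p..snd p} \<subseteq> \<T>" if "p \<in> Q" for p
    using Q(1) that unfolding interval_partition_def by blast
  have cross: "{fst p..snd p} \<inter> {fst q..snd q} = {}" if "p \<in> P" "q \<in> Q" for p q
    using PS[OF that(1)] QT[OF that(2)] assms(3) by blast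
  have "interval_partition (P \<union> Q) (\<S> \<union> \<T>)"
    unfolding interval_partition_def
  proof (intro conjI ballI impI)
    show "(\<Union>p\<in>P \<union> Q. {fst p..snd p}) = \<S> \<union> \<T>"
      using P(1) Q(1) unfolding interval_partition_def by (simp add: UN_Un)
    show "fst p \<subseteq> snd p" if "p \<in> P \<union> Q" for p
      using that P(1) Q(1) unfolding interval_partition_def by blast
    show "{fst p..snd p} \<inter> {fst q..snd q} = {}" if pq: "p \<in> P \<union> Q" "q \<in> P \<union> Q" "p \<noteq> q" for p q
    proof -
      consider "p \<in> P" "q \<in> P" | "p \<in> Q" "q \<in> Q" | "p \<in> P" "q \<in> Q" | "p \<in> Q" "q \<in> P"
        using pq(1,2) by blast
      then show ?thesis
      proof cases
        case 1 then show ?thesis using P(1) pq(3) unfolding interval_partition_def by simp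
      next
        case 2 then show ?thesis using Q(1) pq(3) unfolding interval_partition_def by simp
      next
        case 3 then show ?thesis by (rule cross)
      next
        case 4 then show ?thesis using cross[of q p] by (simp add: Int_commute)
      qed
    qed
  qed
  then show ?thesis using P(2) Q(2) unfolding partitionable_def by blast
qed

lemma partitionable_mono: "partitionable t \<S> \<Longrightarrow> s \<le> t \<Longrightarrow> partitionable s \<S>"
  unfolding partitionable_def by (meson le_trans)

text \<open>
  The interval containing \<open>U\<close> ends in \<open>U\<close>.
\<close>

lemma partitionable_le_card:
  assumes "partitionable t \<S>" "U \<in> \<S>" "\<And>T. T \<in> \<S> \<Longrightarrow> T \<subseteq> U" "finite U"
  shows "t \<le> card U"
proof -
  obtain P where P: "interval_partition P \<S>" "\<forall>p\<in>P. t \<le> card (snd p)"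
    using assms(1) unfolding partitionable_def by blast
  obtain p where p: "p \<in> P" "U \<in> {fst p..snd p}"
    using P(1) assms(2) unfolding interval_partition_def by blast
  have "snd p \<in> {fst p..snd p}" using p(2) by auto
  then have "snd p \<in> \<S>" using P(1) p(1) unfolding interval_partition_def by blast
  then have "card (snd p) \<le> card U" using assms(3,4) by (intro card_mono) auto
  then show ?thesis using P(2) p(1) by force
qed

text \<open>
  Adding the elements of \<open>Y\<close> one at a time, only the nonfaces that contain the new element have to be
  partitioned, and old intervals stay as they are.
\<close>

lemma partitionable_extend:
  fixes Y :: "'a::finite set"
  assumes base: "partitionable t {T. T \<subseteq> U \<and> T \<in> NF}"
    and step: "\<And>W x. U \<subseteq> W \<Longrightarrow> W \<subseteq> U \<union> Y \<Longrightarrow> x \<in> Y \<Longrightarrow> x \<notin> W \<Longrightarrow>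
      partitionable t {T. x \<in> T \<and> T \<subseteq> insert x W \<and> T \<in> NF}"
  shows "partitionable t {T. T \<subseteq> U \<union> Y \<and> T \<in> NF}"
proof -
  have "finite Y" by simp
  moreover have "Z \<subseteq> Y \<Longrightarrow> partitionable t {T. T \<subseteq> U \<union> Z \<and> T \<in> NF}" if "finite Z" for Z
    using that
  proof (induction Z)
    case empty
    then show ?case using base by simp
  next
    case (insert x Z)
    show ?case
    proof (cases "x \<in> U")
      case True
      then have "U \<union> insert x Z = U \<union> Z" by blast
      then show ?thesis using insert by simp
    next
      case False
      have "{T. T \<subseteq> U \<union> insert x Z \<and> T \<in> NF} =
        {T. T \<subseteq> U \<union> Z \<and> T \<in> NF} \<union> {T. x \<in> T \<and> T \<subseteq> insert x (U \<union> Z) \<and> T \<in> NF}"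
        by blast
      moreover have "partitionable t {T. x \<in> T \<and> T \<subseteq> insert x (U \<union> Z) \<and> T \<in> NF}"
        using insert False by (intro step) auto
      moreover have "{T. T \<subseteq> U \<union> Z \<and> T \<in> NF} \<inter> {T. x \<in> T \<and> T \<subseteq> insert x (U \<union> Z) \<and> T \<in> NF} = {}"
        using insert.hyps False by blast
      moreover have "partitionable t {T. T \<subseteq> U \<union> Z \<and> T \<in> NF}"
        using insert by simp
      ultimately show ?thesis
        by (simp only: partitionable_union)
    qed
  qed
  ultimately show ?thesis by blast
qed

text \<open>
  The link of the new vertex \<open>x\<close> is a simplex on \<open>U \<inter> F\<close>, so a set containing \<open>x\<close> is a nonface iff it contains
  a non-neighbour of \<open>x\<close>. It is sorted by its first non-neighbour \<open>y\<close>: the interval of \<open>y\<close> starts at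
  \<open>{x, y}\<close> and omits the non-neighbours before \<open>y\<close>, hence its upper end contains \<open>x\<close>, \<open>y\<close> and all
  neighbours.
\<close>

lemma partitionable_simplicial:
  fixes U :: "'a::finite set"
  assumes x: "x \<notin> U" and t: "t \<le> card (U \<inter> F) + 2"
  shows "partitionable t {T. x \<in> T \<and> T \<subseteq> insert x U \<and> \<not> T \<subseteq> insert x F}"
proof -
  obtain i :: "'a \<Rightarrow> nat" where i: "inj i"
    using finite_imp_inj_to_nat_seg[OF finite_UNIV] by blast
  define L where "L y = {z \<in> U - F. i z < i y}" for y
  show ?thesis
  proof (rule partitionable_family[of "U - F" "\<lambda>y. {x, y}" "\<lambda>y. insert x U - L y"])
    fix y assume y: "y \<in> U - F"
    show "{x, y} \<subseteq> insert x U - L y" using y x by (auto simp: L_def)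
    have "insert x (insert y (U \<inter> F)) \<subseteq> insert x U - L y" using y x by (auto simp: L_def)
    then have "card (insert x (insert y (U \<inter> F))) \<le> card (insert x U - L y)"
      by (intro card_mono) auto
    moreover have "card (insert x (insert y (U \<inter> F))) = card (U \<inter> F) + 2"
      using x y by (auto simp: card_insert_if)
    ultimately show "t \<le> card (insert x U - L y)" using t by simp
  next
    fix y z assume yz: "y \<in> U - F" "z \<in> U - F" "y \<noteq> z"
    then have "i y < i z \<or> i z < i y" using i by (metis injD linorder_neqE_nat)
    then show "{{x, y}..insert x U - L y} \<inter> {{x, z}..insert x U - L z} = {}"
      using yz by (auto simp: L_def)
  next
    show "(\<Union>y\<in>U - F. {{x, y}..insert x U - L y}) = {T. x \<in> T \<and> T \<subseteq> insert x U \<and> \<not> T \<subseteq> insert x F}"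
    proof (intro equalityI subsetI)
      fix T assume "T \<in> (\<Union>y\<in>U - F. {{x, y}..insert x U - L y})"
      then show "T \<in> {T. x \<in> T \<and> T \<subseteq> insert x U \<and> \<not> T \<subseteq> insert x F}"
        using x by auto
    next
      fix T assume T: "T \<in> {T. x \<in> T \<and> T \<subseteq> insert x U \<and> \<not> T \<subseteq> insert x F}"
      then have ex: "\<exists>y. y \<in> T \<inter> (U - F)" by blast
      define y where "y = (ARG_MIN i y. y \<in> T \<inter> (U - F))"
      have y: "y \<in> T \<inter> (U - F)" "\<And>z. z \<in> T \<inter> (U - F) \<Longrightarrow> i y \<le> i z"
        using ex arg_min_nat_lemma[of "\<lambda>y. y \<in> T \<inter> (U - F)" _ i] unfolding y_def by blast+
      have "T \<in> {{x, y}..insert x U - L y}"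
        using T y(1) y(2) by (force simp: L_def)
      then show "T \<in> (\<Union>y\<in>U - F. {{x, y}..insert x U - L y})" using y(1) by blast
    qed
  qed
qed

text \<open>
  Each nonface \<open>{x, y}\<close> is absorbed by the interval from \<open>{x, y}\<close> to \<open>{x, y, w}\<close>; these intervals are disjoint
  because \<open>w\<close> is a neighbour of \<open>x\<close>. All other nonfaces containing \<open>x\<close> have at least three elements
  and form intervals of their own.
\<close>

lemma partitionable_neighbour:
  fixes U :: "'a::finite set"
  assumes up: "upward_closed NF" and x: "x \<notin> U" "{x} \<notin> NF" and w: "w \<in> U" "{x, w} \<notin> NF"
  shows "partitionable 3 {T. x \<in> T \<and> T \<subseteq> insert x U \<and> T \<in> NF}"
proof -
  let ?S = "{T. x \<in> T \<and> T \<subseteq> insert x U \<and> T \<in> NF}"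
  define K where "K = {y \<in> U. {x, y} \<in> NF}"
  define S1 where "S1 = (\<Union>y\<in>K. {{x, y}..{x, y, w}})"
  have K: "y \<in> U" "y \<noteq> x" "y \<noteq> w" "{x, y} \<in> NF" if "y \<in> K" for y using that x w by (auto simp: K_def)
  have "partitionable 3 S1"
  proof (rule partitionable_family[of K "\<lambda>y. {x, y}" "\<lambda>y. {x, y, w}"])
    fix y z assume yz: "y \<in> K" "z \<in> K" "y \<noteq> z"
    then show "{{x, y}..{x, y, w}} \<inter> {{x, z}..{x, z, w}} = {}" using K[OF yz(1)] K[OF yz(2)] by auto
  next
    fix y assume "y \<in> K"
    then have "x \<noteq> y" "x \<noteq> w" "y \<noteq> w" using K[of y] x w by auto
    then show "3 \<le> card {x, y, w}" by simp
  qed (auto simp: S1_def)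
  moreover have "partitionable 3 (?S - S1)"
  proof (rule partitionable_large)
    fix T assume T: "T \<in> ?S - S1"
    then have "T \<noteq> {x}" using x by blast
    then obtain y where y: "y \<in> T" "y \<noteq> x" using T by blast
    have "T \<noteq> {x, y}"
    proof
      assume e: "T = {x, y}"
      then have "y \<in> K" using T y by (auto simp: K_def)
      then have "T \<in> S1" unfolding S1_def e by auto
      then show False using T by blast
    qed
    then obtain z where z: "z \<in> T" "z \<noteq> x" "z \<noteq> y" using T y by blast
    have "card {x, y, z} \<le> card T" using T y z by (intro card_mono) auto
    then show "3 \<le> card T" using y z by simp
  qed
  ultimately have "partitionable 3 (S1 \<union> (?S - S1))"
    by (rule partitionable_union) blast
  moreover have "S1 \<subseteq> ?S"
  proof
    fix T assume "T \<in> S1"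
    then obtain y where y: "y \<in> K" "{x, y} \<subseteq> T" "T \<subseteq> {x, y, w}" by (auto simp: S1_def)
    have "T \<subseteq> insert x U" using y(3) w(1) K(1)[OF y(1)] by auto
    moreover have "x \<in> T" using y(2) by auto
    ultimately show "T \<in> ?S" using upward_closedD[OF up K(4)[OF y(1)] y(2)] by simp
  qed
  ultimately show ?thesis by (simp add: Un_absorb1)
qed

text \<open>
  The elements of \<open>C\<close> are cone points, so they can be added to the upper end of each interval.
\<close>

lemma partitionable_cone:
  fixes C :: "'a::finite set"
  assumes cone: "\<And>T. T \<in> NF \<longleftrightarrow> T - C \<in> NF"
    and "partitionable t {T. T \<subseteq> - C \<and> T \<in> NF}"
  shows "partitionable (t + card C) NF"
proof -
  let ?S = "{T. T \<subseteq> - C \<and> T \<in> NF}"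
  obtain P where P: "interval_partition P ?S" "\<forall>p\<in>P. t \<le> card (snd p)"
    using assms(2) unfolding partitionable_def by blast
  have sub: "fst p \<subseteq> snd p" if "p \<in> P" for p
    using P(1) that unfolding interval_partition_def by blast
  have un: "(\<Union>p\<in>P. {fst p..snd p}) = ?S"
    using P(1) unfolding interval_partition_def by blast
  have C: "snd p \<inter> C = {}" if "p \<in> P" for p
  proof -
    have "snd p \<in> {fst p..snd p}" using sub[OF that] by simp
    then have "snd p \<in> ?S" unfolding un[symmetric] by (rule UN_I[OF that])
    then show ?thesis by blast
  qed
  have mem: "T \<in> {fst p..snd p \<union> C} \<longleftrightarrow> T - C \<in> {fst p..snd p}" if "p \<in> P" for p T
    using C[OF that] sub[OF that] by auto
  show ?thesis
  proof (rule partitionable_family[of P fst "\<lambda>p. snd p \<union> C"])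
    fix p assume p: "p \<in> P"
    show "fst p \<subseteq> snd p \<union> C" using sub[OF p] by blast
    show "t + card C \<le> card (snd p \<union> C)"
      using P(2) p C[OF p] by (subst card_Un_disjoint) auto
  next
    fix p q assume pq: "p \<in> P" "q \<in> P" "p \<noteq> q"
    have "{fst p..snd p} \<inter> {fst q..snd q} = {}"
      using P(1) pq unfolding interval_partition_def by blast
    then show "{fst p..snd p \<union> C} \<inter> {fst q..snd q \<union> C} = {}"
      using mem[OF pq(1)] mem[OF pq(2)] by blast
  next
    have "T \<in> (\<Union>p\<in>P. {fst p..snd p \<union> C}) \<longleftrightarrow> T - C \<in> ?S" for T
      unfolding un[symmetric] using mem by blast
    also have "T - C \<in> ?S \<longleftrightarrow> T \<in> NF" for T using cone[of T] by blast
    finally show "(\<Union>p\<in>P. {fst p..snd p \<union> C}) = NF" by blast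
  qed
qed

text \<open>
  Since \<open>A \<subseteq> B\<close>, exponents at least 1 on \<open>A\<close> are all that divisibility by \<open>x\<^sup>A\<close> requires, and the
  monomials in \<open>x\<^sup>A K[B]\<close> are those whose support lies in the interval \<open>{A..B}\<close>.
\<close>

lemma stanley_space_squarefree:
  assumes "A \<subseteq> B"
  shows "(stanley_space (squarefree_exponent A, B) :: ('v::finite, 'k::field) mpoly set) =
    {f. \<forall>u\<in>Poly_Mapping.keys f. A \<subseteq> Poly_Mapping.keys u \<and> Poly_Mapping.keys u \<subseteq> B}" (is "?L = ?R")
proof
  show "?L \<subseteq> ?R"
    using assms by (force simp: stanley_space_def keys_monomial_mult polys_in_def keys_add_nat)
  show "?R \<subseteq> ?L"
  proof
    fix f :: "('v, 'k) mpoly" assume f: "f \<in> ?R"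
    define g where "g = (\<Sum>u\<in>Poly_Mapping.keys f.
      Poly_Mapping.single (u - squarefree_exponent A) (Poly_Mapping.lookup f u))"
    have split: "squarefree_exponent A + (u - squarefree_exponent A) = u" if "u \<in> Poly_Mapping.keys f" for u
    proof (rule poly_mapping_eqI)
      fix v
      have "v \<in> A \<Longrightarrow> Poly_Mapping.lookup u v \<noteq> 0"
        using f that unfolding in_keys_iff[symmetric] by blast
      then show "Poly_Mapping.lookup (squarefree_exponent A + (u - squarefree_exponent A)) v = Poly_Mapping.lookup u v"
        by (auto simp: lookup_add lookup_minus lookup_squarefree_exponent)
    qed
    have "monomial (squarefree_exponent A) * g =
        (\<Sum>u\<in>Poly_Mapping.keys f. Poly_Mapping.single u (Poly_Mapping.lookup f u))"
      unfolding g_def sum_distrib_left monomial_def mult_single mult_1_left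
      by (intro sum.cong refl) (simp add: split)
    then have "f = monomial (squarefree_exponent A) * g" by (simp add: poly_sum_single)
    moreover have "g \<in> polys_in B"
      unfolding polys_in_def
    proof (intro CollectI ballI)
      fix w assume "w \<in> Poly_Mapping.keys g"
      then have "w \<in> (\<Union>u\<in>Poly_Mapping.keys f. Poly_Mapping.keys
          (Poly_Mapping.single (u - squarefree_exponent A) (Poly_Mapping.lookup f u)))"
        unfolding g_def by (rule subsetD[OF Poly_Mapping.keys_sum])
      then obtain u where u: "u \<in> Poly_Mapping.keys f" "w \<in> Poly_Mapping.keys
          (Poly_Mapping.single (u - squarefree_exponent A) (Poly_Mapping.lookup f u))"
        by (rule UN_E)
      then have "w = u - squarefree_exponent A" by (simp split: if_splits)
      then have "Poly_Mapping.keys w \<subseteq> Poly_Mapping.keys u"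
        by (auto simp: in_keys_iff lookup_minus)
      then show "Poly_Mapping.keys w \<subseteq> B" using f u(1) by blast
    qed
    ultimately show "f \<in> ?L" by (auto simp: stanley_space_def)
  qed
qed

lemma is_direct_sum_support:
  fixes M :: "nat \<Rightarrow> ('v \<Rightarrow>\<^sub>0 nat) set"
  assumes disj: "\<And>i j. i < r \<Longrightarrow> j < r \<Longrightarrow> i \<noteq> j \<Longrightarrow> M i \<inter> M j = {}"
  shows "is_direct_sum {f. Poly_Mapping.keys f \<subseteq> (\<Union>i<r. M i)} r
    (\<lambda>i. {f :: ('v, 'k::field) mpoly. Poly_Mapping.keys f \<subseteq> M i})"
  unfolding is_direct_sum_def
proof (intro conjI allI impI)
  show "{f :: ('v, 'k) mpoly. Poly_Mapping.keys f \<subseteq> (\<Union>i<r. M i)} =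
    {\<Sum>i<r. g i |g. \<forall>i<r. g i \<in> {f. Poly_Mapping.keys f \<subseteq> M i}}" (is "?L = ?R")
  proof
    show "?R \<subseteq> ?L"
    proof
      fix f assume "f \<in> ?R"
      then obtain g where f: "f = (\<Sum>i<r. g i)" and g: "\<forall>i<r. Poly_Mapping.keys (g i) \<subseteq> M i"
        by blast
      have "Poly_Mapping.keys f \<subseteq> (\<Union>i<r. Poly_Mapping.keys (g i))"
        unfolding f by (rule Poly_Mapping.keys_sum)
      then show "f \<in> ?L" using g by blast
    qed
    show "?L \<subseteq> ?R"
    proof
      fix f :: "('v, 'k) mpoly" assume f: "f \<in> ?L"
      define g where "g i = (\<Sum>u\<in>Poly_Mapping.keys f \<inter> M i. Poly_Mapping.single u (Poly_Mapping.lookup f u))" for i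
      have "Poly_Mapping.keys (g i) \<subseteq> M i" for i
      proof -
        have "Poly_Mapping.keys (g i) \<subseteq> (\<Union>u\<in>Poly_Mapping.keys f \<inter> M i.
            Poly_Mapping.keys (Poly_Mapping.single u (Poly_Mapping.lookup f u)))"
          unfolding g_def by (rule Poly_Mapping.keys_sum)
        also have "\<dots> \<subseteq> M i" by (auto split: if_splits)
        finally show ?thesis .
      qed
      moreover have "f = (\<Sum>i<r. g i)"
      proof -
        have "f = (\<Sum>u\<in>(\<Union>i<r. Poly_Mapping.keys f \<inter> M i). Poly_Mapping.single u (Poly_Mapping.lookup f u))"
        proof -
          have "(\<Union>i<r. Poly_Mapping.keys f \<inter> M i) = Poly_Mapping.keys f" using f by blast
          then show ?thesis by (simp add: poly_sum_single)
        qed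
        also have "\<dots> = (\<Sum>i<r. g i)"
          unfolding g_def by (rule sum.UNION_disjoint) (use disj in fastforce)+
        finally show ?thesis .
      qed
      ultimately show "f \<in> ?R" by blast
    qed
  qed
next
  fix g :: "nat \<Rightarrow> ('v, 'k) mpoly" and i
  assume "(\<forall>i<r. g i \<in> {f. Poly_Mapping.keys f \<subseteq> M i}) \<and> (\<Sum>i<r. g i) = 0" and i: "i < r"
  then have g: "Poly_Mapping.keys (g j) \<subseteq> M j" if "j < r" for j using that by blast
  have s: "(\<Sum>i<r. g i) = 0"
    using \<open>(\<forall>i<r. g i \<in> {f. Poly_Mapping.keys f \<subseteq> M i}) \<and> (\<Sum>i<r. g i) = 0\<close> by blast
  have "Poly_Mapping.lookup (g i) u = 0" for u
  proof (rule ccontr)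
    assume nz: "Poly_Mapping.lookup (g i) u \<noteq> 0"
    then have u: "u \<in> M i" using g[OF i] by (auto simp flip: in_keys_iff)
    have "Poly_Mapping.lookup (g j) u = 0" if "j \<in> {..<r} - {i}" for j
    proof -
      have "u \<notin> M j" using disj[OF i, of j] that u by auto
      then show ?thesis using g[of j] that by (auto simp: in_keys_iff)
    qed
    then have "Poly_Mapping.lookup (\<Sum>i<r. g i) u = Poly_Mapping.lookup (g i) u"
      using i by (simp add: lookup_add lookup_sum sum.remove[of "{..<r}" i])
    then show False using nz s by simp
  qed
  then show "g i = 0" by (intro poly_mapping_eqI) simp
qed

lemma interval_partition_stanley_decomposition:
  fixes P :: "('v::finite set \<times> 'v set) set"
  assumes P: "interval_partition P NF" and ps: "set ps = P" "distinct ps"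
  shows "stanley_decomposition (support_ideal NF :: ('v, 'k::field) mpoly set)
    (map (\<lambda>(A, B). (squarefree_exponent A, B)) ps)"
proof -
  define M where "M i = {u :: 'v \<Rightarrow>\<^sub>0 nat. Poly_Mapping.keys u \<in> {fst (ps ! i)..snd (ps ! i)}}" for i
  have sub: "fst p \<subseteq> snd p" if "p \<in> P" for p using P that by (auto simp: interval_partition_def)
  have un: "(\<Union>p\<in>P. {fst p..snd p}) = NF" using P unfolding interval_partition_def by blast
  have mem: "ps ! i \<in> P" if "i < length ps" for i using that ps(1) by auto
  have space: "stanley_space (map (\<lambda>(A, B). (squarefree_exponent A, B)) ps ! i) =
      {f :: ('v, 'k) mpoly. Poly_Mapping.keys f \<subseteq> M i}" if i: "i < length ps" for i
  proof -
    obtain A B where AB: "ps ! i = (A, B)" by fastforce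
    have "A \<subseteq> B" using sub[OF mem[OF i]] AB by auto
    then show ?thesis using i by (auto simp: AB stanley_space_squarefree M_def)
  qed
  have disj: "M i \<inter> M j = {}" if "i < length ps" "j < length ps" "i \<noteq> j" for i j
  proof -
    have "ps ! i \<noteq> ps ! j" using ps(2) that by (simp add: nth_eq_iff_index_eq)
    then have "{fst (ps ! i)..snd (ps ! i)} \<inter> {fst (ps ! j)..snd (ps ! j)} = {}"
      using P mem[OF that(1)] mem[OF that(2)] unfolding interval_partition_def by blast
    then show ?thesis unfolding M_def by blast
  qed
  have ideal: "support_ideal NF = {f :: ('v, 'k) mpoly. Poly_Mapping.keys f \<subseteq> (\<Union>i<length ps. M i)}"
  proof -
    have "P = (!) ps ` {..<length ps}" using ps(1) by (auto simp: set_conv_nth)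
    then have "u \<in> (\<Union>i<length ps. M i) \<longleftrightarrow> Poly_Mapping.keys u \<in> NF" for u
      unfolding un[symmetric] M_def by simp
    then show ?thesis unfolding support_ideal_def by blast
  qed
  have cong: "(\<forall>i<length ps. g i \<in> stanley_space (map (\<lambda>(A, B). (squarefree_exponent A, B)) ps ! i)) \<longleftrightarrow>
      (\<forall>i<length ps. g i \<in> {f. Poly_Mapping.keys f \<subseteq> M i})" for g :: "nat \<Rightarrow> ('v, 'k) mpoly"
    by (intro all_cong) (simp only: space)
  have "is_direct_sum (support_ideal NF) (length ps)
      (\<lambda>i. {f :: ('v, 'k) mpoly. Poly_Mapping.keys f \<subseteq> M i})"
    unfolding ideal by (rule is_direct_sum_support[OF disj])
  then have "is_direct_sum (support_ideal NF :: ('v, 'k) mpoly set) (length ps)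
      (\<lambda>i. stanley_space (map (\<lambda>(A, B). (squarefree_exponent A, B)) ps ! i))"
    unfolding is_direct_sum_def cong .
  moreover have "monomial (squarefree_exponent A) \<in> (support_ideal NF :: ('v, 'k) mpoly set)"
    if "(A, B) \<in> P" for A B
  proof -
    have "A \<in> {fst (A, B)..snd (A, B)}" using sub[OF that] by simp
    then have "A \<in> NF" unfolding un[symmetric] by (rule UN_I[OF that])
    then show ?thesis by (simp add: monomial_in_support_ideal_iff)
  qed
  ultimately show ?thesis
    using ps(1) by (auto simp: stanley_decomposition_def)
qed

lemma sdepth_ge_partitionable:
  fixes NF :: "'v::finite set set"
  assumes part: "partitionable t NF" and ne: "(support_ideal NF :: ('v, 'k::field) mpoly set) \<noteq> {0}"
  shows "t \<le> sdepth (support_ideal NF :: ('v, 'k) mpoly set)"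
proof -
  let ?I = "support_ideal NF :: ('v, 'k) mpoly set"
  let ?S = "{sdepth_decomposition ds |ds. stanley_decomposition ?I ds}"
  have nonempty: "ds \<noteq> []" if "stanley_decomposition ?I ds" for ds
    using that ne by (auto simp: stanley_decomposition_def is_direct_sum_def)
  have "sdepth_decomposition ds \<le> card (UNIV :: 'v set)" if ds: "stanley_decomposition ?I ds" for ds
  proof -
    obtain u Z where uZ: "(u, Z) \<in> set ds" using nonempty[OF ds] by (cases ds) auto
    have "sdepth_decomposition ds \<le> card Z"
      unfolding sdepth_decomposition_def using uZ by (intro Min_le) force+
    also have "\<dots> \<le> card (UNIV :: 'v set)" by (intro card_mono) auto
    finally show ?thesis .
  qed
  then have fin: "finite ?S"
    by (intro finite_subset[of ?S "{..card (UNIV :: 'v set)}"]) auto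
  obtain P where P: "interval_partition P NF" "\<forall>p\<in>P. t \<le> card (snd p)"
    using part unfolding partitionable_def by blast
  obtain ps where ps: "set ps = P" "distinct ps"
    using finite_distinct_list[of P] by auto
  let ?ds = "map (\<lambda>(A, B). (squarefree_exponent A, B)) ps"
  have ds: "stanley_decomposition ?I ?ds"
    by (rule interval_partition_stanley_decomposition[OF P(1) ps])
  have "t \<le> sdepth_decomposition ?ds"
    unfolding sdepth_decomposition_def
  proof (rule Min.boundedI)
    show "(\<lambda>(u, Z). card Z) ` set ?ds \<noteq> {}" using nonempty[OF ds] by simp
    show "t \<le> a" if "a \<in> (\<lambda>(u, Z). card Z) ` set ?ds" for a
      using that P(2) ps(1) by fastforce
  qed simp
  also have "\<dots> \<le> sdepth ?I"
    unfolding sdepth_def using fin ds by (intro Max_ge) auto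
  finally show ?thesis .
qed


section \<open>Complexes whose triple intersections of facets are constant\<close>

text \<open>
  Connected families of facets: each new facet meets an earlier one outside \<open>C\<close>.
\<close>

inductive grown :: "'a set set \<Rightarrow> 'a set \<Rightarrow> 'a set set \<Rightarrow> bool" for Fac C
  where
    start: "F \<in> Fac \<Longrightarrow> grown Fac C {F}"
  | grow: "grown Fac C Q \<Longrightarrow> F \<in> Fac \<Longrightarrow> F \<notin> Q \<Longrightarrow> G \<in> Q \<Longrightarrow> z \<in> F \<Longrightarrow> z \<in> G \<Longrightarrow> z \<notin> C \<Longrightarrow>
      grown Fac C (insert F Q)"

lemma grown_subset: "grown Fac C Q \<Longrightarrow> Q \<subseteq> Fac"
  by (induction rule: grown.induct) auto

lemma grown_nonempty: "grown Fac C Q \<Longrightarrow> Q \<noteq> {}"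
  by (induction rule: grown.induct) auto

lemma exists_maximal_grown:
  assumes "finite Fac" "Fac \<noteq> {}"
  obtains Q where "grown Fac C Q"
    "\<And>F G. F \<in> Fac \<Longrightarrow> F \<notin> Q \<Longrightarrow> G \<in> Q \<Longrightarrow> F \<inter> G \<subseteq> C"
proof -
  let ?X = "{Q. grown Fac C Q}"
  have "finite ?X"
    by (rule finite_subset[of _ "Pow Fac"]) (use assms(1) grown_subset in blast)+
  moreover have "?X \<noteq> {}" using assms(2) grown.start by blast
  ultimately obtain Q where Q: "Q \<in> ?X" "\<forall>R\<in>?X. Q \<subseteq> R \<longrightarrow> Q = R"
    using finite_has_maximal[of ?X] by blast
  have "F \<inter> G \<subseteq> C" if F: "F \<in> Fac" "F \<notin> Q" "G \<in> Q" for F G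
  proof (rule ccontr)
    assume "\<not> F \<inter> G \<subseteq> C"
    then obtain z where "z \<in> F" "z \<in> G" "z \<notin> C" by blast
    then have "insert F Q \<in> ?X" using grown.grow[of Fac C Q F G z] Q(1) F by simp
    then show False using Q(2) F(2) by blast
  qed
  then show ?thesis using that Q(1) by blast
qed

locale facet_complex =
  fixes Fac :: "'v::finite set set" and C :: "'v set" and NF :: "'v set set"
  assumes NF_def: "NF = {T. \<forall>F\<in>Fac. \<not> T \<subseteq> F}"
    and C_def: "C = \<Inter> Fac"
    and nonempty: "Fac \<noteq> {}"
    and proper: "UNIV \<notin> Fac"
    and antichain: "\<And>F G. F \<in> Fac \<Longrightarrow> G \<in> Fac \<Longrightarrow> F \<subseteq> G \<Longrightarrow> F = G"
    and triple: "\<And>F G H. F \<in> Fac \<Longrightarrow> G \<in> Fac \<Longrightarrow> H \<in> Fac \<Longrightarrow> F \<noteq> G \<Longrightarrow> F \<noteq> H \<Longrightarrow> G \<noteq> H \<Longrightarrow>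
      F \<inter> G \<inter> H \<subseteq> C"
begin

lemma face: "F \<in> Fac \<Longrightarrow> T \<subseteq> F \<Longrightarrow> T \<notin> NF"
  by (auto simp: NF_def)

lemma nonface_iff: "T \<notin> NF \<longleftrightarrow> (\<exists>F\<in>Fac. T \<subseteq> F)"
  by (auto simp: NF_def)

lemma upward_closed_NF: "upward_closed NF"
  by (auto simp: upward_closed_def NF_def)

lemma C_subset: "F \<in> Fac \<Longrightarrow> C \<subseteq> F"
  by (auto simp: C_def)

lemma partition_add_facet:
  assumes base: "partitionable t {T. T \<subseteq> \<Union> Q - C \<and> T \<in> NF}"
    and step: "\<And>W x. \<Union> Q - C \<subseteq> W \<Longrightarrow> W \<subseteq> \<Union> Q \<union> F - C \<Longrightarrow> x \<in> F \<Longrightarrow> x \<notin> C \<Longrightarrow> x \<notin> \<Union> Q \<Longrightarrow> x \<notin> W \<Longrightarrow>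
      partitionable t {T. x \<in> T \<and> T \<subseteq> insert x W \<and> T \<in> NF}"
  shows "partitionable t {T. T \<subseteq> \<Union> (insert F Q) - C \<and> T \<in> NF}"
proof -
  have "partitionable t {T. T \<subseteq> (\<Union> Q - C) \<union> (F - C - \<Union> Q) \<and> T \<in> NF}"
    using base
  proof (rule partitionable_extend)
    fix W x assume "\<Union> Q - C \<subseteq> W" "W \<subseteq> (\<Union> Q - C) \<union> (F - C - \<Union> Q)" "x \<in> F - C - \<Union> Q" "x \<notin> W"
    then show "partitionable t {T. x \<in> T \<and> T \<subseteq> insert x W \<and> T \<in> NF}"
      by (intro step) auto
  qed
  moreover have "(\<Union> Q - C) \<union> (F - C - \<Union> Q) = \<Union> (insert F Q) - C" by blast
  ultimately show ?thesis by simp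
qed

lemma partition_facet:
  assumes "F \<in> Fac"
  shows "partitionable t {T. T \<subseteq> \<Union> {F} - C \<and> T \<in> NF}"
proof -
  have no_nonface: "{T. T \<subseteq> \<Union> {F} - C \<and> T \<in> NF} = {}" using face[OF assms] by auto
  show ?thesis unfolding no_nonface by (rule partitionable_large) simp
qed

text \<open>
  Each new vertex of \<open>F\<close> is adjacent to the vertex \<open>z\<close> along which \<open>F\<close> is attached.
\<close>

lemma grown_partition_3:
  assumes "grown Fac C Q"
  shows "partitionable 3 {T. T \<subseteq> \<Union> Q - C \<and> T \<in> NF}"
  using assms
proof (induction rule: grown.induct)
  case (start F)
  then show ?case by (rule partition_facet)
next
  case (grow Q F G z)
  show ?case
  proof (rule partition_add_facet[OF grow.IH])
    fix W x assume W: "\<Union> Q - C \<subseteq> W" "x \<in> F" "x \<notin> W"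
    show "partitionable 3 {T. x \<in> T \<and> T \<subseteq> insert x W \<and> T \<in> NF}"
    proof (rule partitionable_neighbour[OF upward_closed_NF])
      show "z \<in> W" using W grow.hyps by blast
      show "{x} \<notin> NF" "{x, z} \<notin> NF" using W(2) grow.hyps by (auto intro!: face[OF grow.hyps(2)])
    qed (rule W(3))
  qed
qed

text \<open>
  If every facet is attached along a single earlier facet \<open>G\<close>, then the link of a new vertex of \<open>F\<close> is a
  simplex that contains \<open>F \<inter> G\<close>: another facet \<open>H\<close> through the new vertex meets \<open>F\<close> outside \<open>C\<close>, and it is
  attached later, so that it cannot meet a second facet of the family outside \<open>C\<close>.
\<close>

lemma grown_partition_tree:
  assumes "grown Fac C Q"
    and unique: "\<And>Q F G G'. grown Fac C Q \<Longrightarrow> F \<in> Fac \<Longrightarrow> F \<notin> Q \<Longrightarrow> G \<in> Q \<Longrightarrow> G' \<in> Q \<Longrightarrow>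
      \<not> F \<inter> G \<subseteq> C \<Longrightarrow> \<not> F \<inter> G' \<subseteq> C \<Longrightarrow> G = G'"
    and edge: "\<And>F G. F \<in> Fac \<Longrightarrow> G \<in> Fac \<Longrightarrow> F \<noteq> G \<Longrightarrow> \<not> F \<inter> G \<subseteq> C \<Longrightarrow> t \<le> card (F \<inter> G - C) + 2"
  shows "partitionable t {T. T \<subseteq> \<Union> Q - C \<and> T \<in> NF}"
  using assms(1)
proof (induction rule: grown.induct)
  case (start F)
  then show ?case by (rule partition_facet)
next
  case (grow Q F G z)
  have grown': "grown Fac C (insert F Q)" using grow.hyps by (rule grown.grow)
  have G: "G \<in> Fac" using grown_subset[OF grow.hyps(1)] grow.hyps by blast
  show ?case
  proof (rule partition_add_facet[OF grow.IH])
    fix W x assume W: "\<Union> Q - C \<subseteq> W" "W \<subseteq> \<Union> Q \<union> F - C" "x \<in> F" "x \<notin> C" "x \<notin> \<Union> Q" "x \<notin> W"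
    have t: "t \<le> card (W \<inter> F) + 2"
    proof -
      have "t \<le> card (F \<inter> G - C) + 2" using edge[OF grow.hyps(2) G] grow.hyps by blast
      moreover have "card (F \<inter> G - C) \<le> card (W \<inter> F)"
        using W(1) grow.hyps by (intro card_mono) auto
      ultimately show ?thesis by simp
    qed
    have link: "T \<in> NF \<longleftrightarrow> \<not> T \<subseteq> insert x F" if T: "x \<in> T" "T \<subseteq> insert x W" for T
    proof
      show "\<not> T \<subseteq> insert x F" if "T \<in> NF"
        using that face[OF grow.hyps(2), of T] W(3) by (auto simp: insert_absorb)
      show "T \<in> NF" if not: "\<not> T \<subseteq> insert x F"
      proof (rule ccontr)
        assume "T \<notin> NF"
        then obtain H where H: "H \<in> Fac" "T \<subseteq> H" unfolding nonface_iff by blast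
        obtain y where y: "y \<in> T" "y \<notin> F" "y \<noteq> x" using not by blast
        then obtain G' where G': "G' \<in> Q" "y \<in> G'" "y \<notin> C" using T W(2) by blast
        have "H \<noteq> F" using H y by blast
        moreover have "H \<notin> Q" using W(5) H T by blast
        ultimately have "G' = F"
          using unique[OF grown' H(1), of G' F] G' y H T W by blast
        then show False using grow.hyps G' by blast
      qed
    qed
    have "{T. x \<in> T \<and> T \<subseteq> insert x W \<and> T \<in> NF} = {T. x \<in> T \<and> T \<subseteq> insert x W \<and> \<not> T \<subseteq> insert x F}"
      using link by blast
    then show "partitionable t {T. x \<in> T \<and> T \<subseteq> insert x W \<and> T \<in> NF}"
      using partitionable_simplicial[OF W(6) t] by simp
  qed
qed

text \<open>
  A variable that is in no facet turns every set into a nonface, so a single interval covers all sets that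
  contain it.
\<close>

lemma partition_extend_to_all:
  assumes part: "partitionable t {T. T \<subseteq> \<Union> Fac - C \<and> T \<in> NF}"
    and t: "t \<le> card (\<Union> Fac - C) + 1"
  shows "partitionable (t + card C) NF"
proof (rule partitionable_cone)
  show "T \<in> NF \<longleftrightarrow> T - C \<in> NF" for T
  proof -
    have "T \<subseteq> F \<longleftrightarrow> T - C \<subseteq> F" if "F \<in> Fac" for F
      using C_subset[OF that] by blast
    then show ?thesis by (simp add: NF_def)
  qed
  have "partitionable t {T. T \<subseteq> (\<Union> Fac - C) \<union> (- C - \<Union> Fac) \<and> T \<in> NF}"
    using part
  proof (rule partitionable_extend)
    fix W x assume W: "\<Union> Fac - C \<subseteq> W" "x \<in> - C - \<Union> Fac" "x \<notin> W"
    have "card (\<Union> Fac - C) \<le> card W" using W(1) by (intro card_mono) auto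
    then have "partitionable t {T. x \<in> T \<and> T \<subseteq> insert x W}"
      using t W(3) by (intro partitionable_family[of "{x}" "\<lambda>x. {x}" "\<lambda>x. insert x W"]) auto
    moreover have "{T. x \<in> T \<and> T \<subseteq> insert x W \<and> T \<in> NF} = {T. x \<in> T \<and> T \<subseteq> insert x W}"
      using W(2) by (auto simp: NF_def)
    ultimately show "partitionable t {T. x \<in> T \<and> T \<subseteq> insert x W \<and> T \<in> NF}" by simp
  qed
  moreover have "(\<Union> Fac - C) \<union> (- C - \<Union> Fac) = - C" by blast
  ultimately show "partitionable t {T. T \<subseteq> - C \<and> T \<in> NF}" by simp
qed

context
  fixes fs :: "('v, 'k::field) mpoly list"
  assumes reg: "regular_sequence_on mpoly_ring (support_ideal NF) fs" and fs: "set fs \<subseteq> max_ideal"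
begin

text \<open>
  If the regular sequence is long, then the edge between \<open>F\<close> and \<open>G\<close> of the facet graph is a bridge: away
  from \<open>F \<inter> G\<close>, the variables split into a set \<open>Y\<close> on the side of \<open>G\<close> and a complement on the side of \<open>F\<close>,
  and every facet stays on one side. The blocks are \<open>F \<inter> G\<close> without \<open>C\<close>, the rest of \<open>F\<close>, and the
  variables outside \<open>F\<close>; a facet that meets the first two must be \<open>F\<close>, by the condition on triple
  intersections, so it does not meet the third.
\<close>

lemma edge_cut:
  assumes F: "F \<in> Fac" and G: "G \<in> Fac" and FG: "F \<noteq> G" and z: "z \<in> F" "z \<in> G" "z \<notin> C"
    and long: "card C + 3 < length fs"
  shows "\<exists>Y. Y \<inter> F = {} \<and> G - F \<subseteq> Y \<and> (\<forall>H\<in>Fac. H \<inter> Y \<noteq> {} \<longrightarrow> H - F \<inter> G \<subseteq> Y)"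
proof -
  let ?A = "F \<inter> G - C" and ?B = "F - G" and ?D = "- F"
  have CF: "C \<subseteq> F" "C \<subseteq> G" using C_subset F G by auto
  have "\<exists>Y. Y \<subseteq> ?D \<and> (\<forall>y\<in>?D. {z, y} \<notin> NF \<longrightarrow> y \<in> Y) \<and>
    (\<forall>x\<in>Y. \<forall>y\<in>?D. {x, y} \<notin> NF \<longrightarrow> y \<in> Y) \<and>
    (\<forall>x\<in>Y. \<forall>b\<in>?B. {z, b} \<notin> NF \<longrightarrow> {x, b} \<in> NF)"
  proof (rule regular_sequence_separation[OF upward_closed_NF reg fs, of ?A ?B ?D C z])
    show "C = - (?A \<union> ?B \<union> ?D)" using CF by blast
    show "{u, v, w} \<in> NF" if uvw: "u \<in> ?A" "v \<in> ?B" "w \<in> ?D" for u v w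
    proof (rule ccontr)
      assume "{u, v, w} \<notin> NF"
      then obtain H where H: "H \<in> Fac" "{u, v, w} \<subseteq> H" unfolding nonface_iff by blast
      have "H \<noteq> F" "H \<noteq> G" using H uvw by auto
      then have "F \<inter> G \<inter> H \<subseteq> C" using triple F G H(1) FG by metis
      then show False using uvw H by blast
    qed
    show "?A \<inter> ?B = {}" "?A \<inter> ?D = {}" "?B \<inter> ?D = {}" by blast+
    show "z \<in> ?A" using z by blast
  qed (rule long)
  then obtain Y where Y: "Y \<subseteq> ?D" "\<forall>y\<in>?D. {z, y} \<notin> NF \<longrightarrow> y \<in> Y"
    "\<forall>x\<in>Y. \<forall>y\<in>?D. {x, y} \<notin> NF \<longrightarrow> y \<in> Y"
    "\<forall>x\<in>Y. \<forall>b\<in>?B. {z, b} \<notin> NF \<longrightarrow> {x, b} \<in> NF"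
    by (elim exE conjE)
  show ?thesis
  proof (intro exI[of _ Y] conjI ballI impI)
    show "Y \<inter> F = {}" using Y(1) by blast
    show "G - F \<subseteq> Y"
    proof
      fix y assume y: "y \<in> G - F"
      have "{z, y} \<notin> NF" using face[OF G, of "{z, y}"] z y by blast
      then show "y \<in> Y" using Y(2) y by blast
    qed
    show "H - F \<inter> G \<subseteq> Y" if H: "H \<in> Fac" "H \<inter> Y \<noteq> {}" for H
    proof
      fix y assume y: "y \<in> H - F \<inter> G"
      obtain x where x: "x \<in> H" "x \<in> Y" using H(2) by blast
      have xy: "{x, y} \<notin> NF" using face[OF H(1), of "{x, y}"] x y by blast
      have "y \<notin> F"
      proof
        assume "y \<in> F"
        then have "{z, y} \<notin> NF" "y \<in> ?B" using face[OF F, of "{z, y}"] z y by auto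
        then show False using Y(4) x(2) xy by blast
      qed
      then show "y \<in> Y" using Y(3) x(2) xy by blast
    qed
  qed
qed

text \<open>
  Removing the bridge \<open>F \<inter> G\<close> disconnects the complex.
\<close>

lemma length_le_edge:
  assumes F: "F \<in> Fac" and G: "G \<in> Fac" and FG: "F \<noteq> G" and "\<not> F \<inter> G \<subseteq> C"
    and long: "card C + 3 < length fs"
  shows "length fs \<le> card (F \<inter> G) + 2"
proof -
  obtain z where z: "z \<in> F" "z \<in> G" "z \<notin> C" using assms(4) by blast
  obtain Y where Y': "Y \<inter> F = {}" "G - F \<subseteq> Y" "\<forall>H\<in>Fac. H \<inter> Y \<noteq> {} \<longrightarrow> H - F \<inter> G \<subseteq> Y"
    using edge_cut[OF F G FG z long] by (elim exE conjE)
  note Y = Y'(1,2) Y'(3)[rule_format]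
  obtain a where a: "a \<in> G - F" using antichain[OF G F] FG by blast
  obtain b where b: "b \<in> F - G" using antichain[OF F G] FG by blast
  show ?thesis
  proof (rule regular_sequence_length_le_cut[OF upward_closed_NF reg fs])
    show "Y \<inter> (F \<inter> G) = {}" using Y(1) by blast
    show "{x, y} \<in> NF" if xy: "x \<in> Y" "y \<notin> Y" "y \<notin> F \<inter> G" for x y
    proof (rule ccontr)
      assume "{x, y} \<notin> NF"
      then obtain H where "H \<in> Fac" "{x, y} \<subseteq> H" unfolding nonface_iff by blast
      then show False using Y(3)[of H] xy by blast
    qed
    show "a \<in> Y" "{a} \<notin> NF" using a Y(2) face[OF G, of "{a}"] by auto
    show "b \<notin> Y" "b \<notin> F \<inter> G" "{b} \<notin> NF" using b Y(1) face[OF F, of "{b}"] by auto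
  qed
qed

text \<open>
  A connected family without \<open>F\<close> stays on one side of the bridge between \<open>F\<close> and \<open>G\<close>, namely on the side
  \<open>Y\<close> of \<open>G\<close>. A second facet \<open>G'\<close> in it that meets \<open>F\<close> outside \<open>C\<close> would have a vertex in \<open>F \<inter> Y\<close>.
\<close>

lemma grown_attaches_once:
  assumes long: "card C + 3 < length fs"
    and Q: "grown Fac C Q" and F: "F \<in> Fac" "F \<notin> Q" and G: "G \<in> Q" "\<not> F \<inter> G \<subseteq> C"
    and G': "G' \<in> Q" "\<not> F \<inter> G' \<subseteq> C"
  shows "G = G'"
proof (rule ccontr)
  assume GG': "G \<noteq> G'"
  have QF: "Q \<subseteq> Fac" by (rule grown_subset[OF Q])
  have GF: "G \<in> Fac" "G' \<in> Fac" "F \<noteq> G" "F \<noteq> G'" using QF G G' F by auto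
  obtain z where z: "z \<in> F" "z \<in> G" "z \<notin> C" using G(2) by blast
  obtain z' where z': "z' \<in> F" "z' \<in> G'" "z' \<notin> C" using G'(2) by blast
  obtain Y where Y': "Y \<inter> F = {}" "G - F \<subseteq> Y" "\<forall>H\<in>Fac. H \<inter> Y \<noteq> {} \<longrightarrow> H - F \<inter> G \<subseteq> Y"
    using edge_cut[OF F(1) GF(1) GF(3) z long] by (elim exE conjE)
  note Y = Y'(1,2) Y'(3)[rule_format]
  \<comment> \<open>by the condition on triple intersections, two facets other than \<open>F\<close> that meet outside \<open>C\<close>
     meet outside \<open>F\<close>, hence lie on the same side\<close>
  have sides: "(\<forall>H\<in>R. H - F \<inter> G \<subseteq> Y) \<or> (\<forall>H\<in>R. H \<inter> Y = {})" if "grown Fac C R" "F \<notin> R" for R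
    using that
  proof (induction rule: grown.induct)
    case (start H)
    then show ?case using Y(3)[of H] by blast
  next
    case (grow R H K y)
    have "K \<in> Fac" using grown_subset[OF grow.hyps(1)] grow.hyps by blast
    then have "F \<inter> H \<inter> K \<subseteq> C"
      using triple[OF F(1) grow.hyps(2), of K] grow.hyps grow.prems by blast
    then have y: "y \<notin> F \<inter> G" using grow.hyps by blast
    have "F \<notin> R" using grow.prems by blast
    then consider "\<forall>H\<in>R. H - F \<inter> G \<subseteq> Y" | "\<forall>H\<in>R. H \<inter> Y = {}" using grow.IH by blast
    then show ?case
    proof cases
      case 1
      then have "y \<in> Y" using grow.hyps y by blast
      then show ?thesis using 1 Y(3)[OF grow.hyps(2)] grow.hyps by blast
    next
      case 2
      then have "y \<notin> Y" using grow.hyps by blast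
      then have "H \<inter> Y = {}" using Y(3)[OF grow.hyps(2)] grow.hyps y by blast
      then show ?thesis using 2 by blast
    qed
  qed
  obtain a where "a \<in> G - F" using antichain[OF GF(1) F(1)] GF(3) by blast
  then have "G \<inter> Y \<noteq> {}" using Y(2) by blast
  then have "G' - F \<inter> G \<subseteq> Y" using sides[OF Q F(2)] G(1) G'(1) by blast
  moreover have "F \<inter> G \<inter> G' \<subseteq> C"
    using triple[OF F(1) GF(1) GF(2) GF(3) GF(4) GG'] .
  ultimately have "z' \<in> Y" using z' by blast
  then show False using Y(1) z' by blast
qed

text \<open>
  The values \<open>t = 1, 2, 3\<close> and \<open>d - card C\<close> belong to a single facet, a disconnected facet graph, a
  connected one with \<open>d \<le> card C + 3\<close>, and a tree.
\<close>

theorem partitionable_length: "partitionable (length fs) NF"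
proof -
  have "\<exists>t. partitionable t {T. T \<subseteq> \<Union> Fac - C \<and> T \<in> NF} \<and> t \<le> card (\<Union> Fac - C) + 1 \<and>
    length fs \<le> t + card C" (is "?goal")
  proof (cases "\<exists>F. Fac = {F}")
    case True
    then obtain F where F: "Fac = {F}" by blast
    then have "C = F" by (simp add: C_def)
    have "length fs \<le> card C + 1"
    proof (rule regular_sequence_length_le_facet[OF upward_closed_NF reg fs])
      show "{} \<notin> NF" using F by (simp add: NF_def)
      show "{v} \<in> NF" if "v \<notin> C" for v using that F \<open>C = F\<close> by (simp add: NF_def)
      show "C \<noteq> UNIV" using F \<open>C = F\<close> proper by blast
    qed
    moreover have "partitionable 1 {T. T \<subseteq> \<Union> Fac - C \<and> T \<in> NF}"
      using partition_facet[of F 1] F by simp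
    ultimately show ?thesis by (intro exI[of _ 1]) simp
  next
    case False
    have other: "\<exists>G\<in>Fac. G \<noteq> F" for F
    proof (rule ccontr)
      assume "\<not> (\<exists>G\<in>Fac. G \<noteq> F)"
      then have "Fac = {F}" using nonempty by auto
      then show False using \<open>\<nexists>F. Fac = {F}\<close> by simp
    qed
    have not_C: "\<not> F \<subseteq> C" if F: "F \<in> Fac" for F
    proof -
      obtain G where G: "G \<in> Fac" "G \<noteq> F" using other by blast
      then have "\<not> F \<subseteq> G" using antichain[OF F G(1)] by blast
      then show ?thesis using C_subset[OF G(1)] by blast
    qed
    have union: "\<Union> Fac - C \<in> NF"
    proof (rule ccontr)
      assume "\<Union> Fac - C \<notin> NF"
      then obtain F where F: "F \<in> Fac" "\<Union> Fac - C \<subseteq> F" unfolding nonface_iff by blast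
      obtain G where G: "G \<in> Fac" "G \<noteq> F" using other by blast
      have "G \<subseteq> F" using F G C_subset[OF F(1)] by blast
      then show False using antichain[OF G(1) F(1)] G(2) by blast
    qed
    have enough: ?goal
      if t: "partitionable t {T. T \<subseteq> \<Union> Fac - C \<and> T \<in> NF}" "length fs \<le> t + card C" for t
    proof -
      have "t \<le> card (\<Union> Fac - C)"
        by (rule partitionable_le_card[OF t(1)]) (use union in auto)
      then show ?thesis using t by (intro exI[of _ t]) simp
    qed
    obtain Q where Q: "grown Fac C Q" "\<And>F G. F \<in> Fac \<Longrightarrow> F \<notin> Q \<Longrightarrow> G \<in> Q \<Longrightarrow> F \<inter> G \<subseteq> C"
      using exists_maximal_grown[OF finite nonempty] by blast
    have QF: "Q \<subseteq> Fac" by (rule grown_subset[OF Q(1)])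
    show ?thesis
    proof (cases "Q = Fac")
      case False
      then obtain G where G: "G \<in> Fac" "G \<notin> Q" using QF by blast
      obtain F where F: "F \<in> Q" "F \<in> Fac" using grown_nonempty[OF Q(1)] QF by blast
      obtain a where a: "a \<in> F" "a \<notin> C" using not_C[OF F(2)] by blast
      obtain b where b: "b \<in> G" "b \<notin> C" using not_C[OF G(1)] by blast
      have "length fs \<le> card C + 2"
      proof (rule regular_sequence_length_le_cut[OF upward_closed_NF reg fs])
        show "(\<Union> Q - C) \<inter> C = {}" by blast
        show "{x, y} \<in> NF" if xy: "x \<in> \<Union> Q - C" "y \<notin> \<Union> Q - C" "y \<notin> C" for x y
        proof (rule ccontr)
          assume "{x, y} \<notin> NF"
          then obtain H where H: "H \<in> Fac" "{x, y} \<subseteq> H" unfolding nonface_iff by blast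
          have "H \<notin> Q" using H xy by blast
          then show False using Q(2)[OF H(1)] H xy by blast
        qed
        show "a \<in> \<Union> Q - C" "{a} \<notin> NF" using a F face[OF F(2), of "{a}"] by auto
        show "b \<notin> \<Union> Q - C" using b Q(2)[OF G] by blast
        show "b \<notin> C" "{b} \<notin> NF" using b face[OF G(1), of "{b}"] by auto
      qed
      moreover have "partitionable 2 {T. T \<subseteq> \<Union> Fac - C \<and> T \<in> NF}"
      proof (rule partitionable_large)
        fix T assume T: "T \<in> {T. T \<subseteq> \<Union> Fac - C \<and> T \<in> NF}"
        have "T \<noteq> {}" using T nonempty by (auto simp: NF_def)
        then obtain x where x: "x \<in> T" by blast
        then obtain H where H: "H \<in> Fac" "x \<in> H" using T by blast
        then have "T \<noteq> {x}" using T face[OF H(1), of "{x}"] by blast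
        then obtain y where y: "y \<in> T" "y \<noteq> x" using x by blast
        have "card {x, y} \<le> card T" using x y by (intro card_mono) auto
        then show "2 \<le> card T" using y by simp
      qed
      ultimately show ?thesis by (intro enough) auto
    next
      case True
      show ?thesis
      proof (cases "length fs \<le> card C + 3")
        case short: True
        show ?thesis using grown_partition_3[OF Q(1)] True short by (intro enough) auto
      next
        case False
        then have long: "card C + 3 < length fs" by simp
        have "partitionable (length fs - card C) {T. T \<subseteq> \<Union> Q - C \<and> T \<in> NF}"
        proof (rule grown_partition_tree[OF Q(1)])
          show "length fs - card C \<le> card (F \<inter> G - C) + 2"
            if FG: "F \<in> Fac" "G \<in> Fac" "F \<noteq> G" "\<not> F \<inter> G \<subseteq> C" for F G
          proof -
            have "C \<subseteq> F \<inter> G" using C_subset FG by blast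
            then have "card (F \<inter> G - C) + card C = card (F \<inter> G)"
              by (simp add: card_Diff_subset card_mono)
            then show ?thesis using length_le_edge[OF FG long] by simp
          qed
        qed (rule grown_attaches_once[OF long])
        then show ?thesis using True by (intro enough) auto
      qed
    qed
  qed
  then obtain t where t: "partitionable t {T. T \<subseteq> \<Union> Fac - C \<and> T \<in> NF}"
    "t \<le> card (\<Union> Fac - C) + 1" "length fs \<le> t + card C"
    by (elim exE conjE)
  show ?thesis
    by (rule partitionable_mono[OF partition_extend_to_all[OF t(1,2)] t(3)])
qed

end

end


section \<open>Minimal primes and facets\<close>

text \<open>
  The product of the leading terms of two polynomials outside the ideal, taken among the monomials supported
  in \<open>F\<close>, cannot cancel.
\<close>

lemma prime_support_ideal:
  fixes F :: "'v::finite set"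
  shows "primeideal (support_ideal {T. \<not> T \<subseteq> F} :: ('v, 'k::field) mpoly set) mpoly_ring"
proof (rule primeidealI)
  let ?P = "support_ideal {T. \<not> T \<subseteq> F} :: ('v, 'k) mpoly set"
  show "ideal ?P mpoly_ring"
    by (rule ideal_support_ideal) (auto simp: upward_closed_def)
  show "cring (mpoly_ring :: ('v, 'k) mpoly ring)" by (rule cring_from_type_algebra)
  have "monomial 0 \<notin> ?P" by (simp add: monomial_in_support_ideal_iff)
  then show "carrier mpoly_ring \<noteq> ?P" by (auto simp: ring_of_type_algebra_def)
  fix f g :: "('v, 'k) mpoly"
  assume fg: "f \<otimes>\<^bsub>mpoly_ring\<^esub> g \<in> ?P"
  show "f \<in> ?P \<or> g \<in> ?P"
  proof (rule ccontr)
    assume neither: "\<not> (f \<in> ?P \<or> g \<in> ?P)"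
    obtain i :: "'v \<Rightarrow> nat" where i: "inj i"
      using finite_imp_inj_to_nat_seg[OF finite_UNIV] by blast
    \<comment> \<open>numbering the variables embeds the exponents additively into \<open>nat \<Rightarrow>\<^sub>0 nat\<close>, whose linear order serves as monomial order\<close>
    define \<psi> :: "('v \<Rightarrow>\<^sub>0 nat) \<Rightarrow> (nat \<Rightarrow>\<^sub>0 nat)"
      where "\<psi> u = (\<Sum>v\<in>UNIV. Poly_Mapping.single (i v) (Poly_Mapping.lookup u v))" for u
    have lookup_\<psi>: "Poly_Mapping.lookup (\<psi> u) (i v) = Poly_Mapping.lookup u v" for u v
      using i by (simp add: \<psi>_def lookup_sum lookup_single when_def inj_eq)
    have inj_\<psi>: "u = w" if "\<psi> u = \<psi> w" for u w
      using lookup_\<psi>[of u] lookup_\<psi>[of w] that by (intro poly_mapping_eqI) metis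
    have add_\<psi>: "\<psi> (u + w) = \<psi> u + \<psi> w" for u w
      by (simp add: \<psi>_def lookup_add single_add sum.distrib)
    let ?K = "\<lambda>p :: ('v, 'k) mpoly. {u \<in> Poly_Mapping.keys p. Poly_Mapping.keys u \<subseteq> F}"
    have lead: "\<exists>u\<in>?K p. \<forall>w\<in>?K p. \<psi> w \<le> \<psi> u" if "p \<notin> ?P" for p
    proof -
      have ne: "?K p \<noteq> {}" using that by (auto simp: support_ideal_def)
      have "Max (\<psi> ` ?K p) \<in> \<psi> ` ?K p" using ne by (intro Max_in) auto
      then obtain u where "u \<in> ?K p" "\<psi> u = Max (\<psi> ` ?K p)" by force
      then show ?thesis by (intro bexI[of _ u]) auto
    qed
    obtain u where u: "u \<in> ?K f" "\<And>w. w \<in> ?K f \<Longrightarrow> \<psi> w \<le> \<psi> u" using lead neither by blast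
    obtain w where w: "w \<in> ?K g" "\<And>w'. w' \<in> ?K g \<Longrightarrow> \<psi> w' \<le> \<psi> w" using lead neither by blast
    have only: "u' = u \<and> w' = w"
      if uw: "u' \<in> Poly_Mapping.keys f" "w' \<in> Poly_Mapping.keys g" "u' + w' = u + w" for u' w'
    proof -
      have "Poly_Mapping.keys u' \<union> Poly_Mapping.keys w' \<subseteq> F"
        using u(1) w(1) keys_add_nat[of u' w'] keys_add_nat[of u w] uw(3) by auto
      then have le: "\<psi> u' \<le> \<psi> u" "\<psi> w' \<le> \<psi> w" using u(2) w(2) uw by auto
      have eq: "\<psi> u' + \<psi> w' = \<psi> u + \<psi> w" using uw(3) by (simp flip: add_\<psi>)
      have "\<psi> u' = \<psi> u"
      proof (rule ccontr)
        assume "\<psi> u' \<noteq> \<psi> u"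
        then have "\<psi> u' + \<psi> w' < \<psi> u + \<psi> w" using le by (intro add_less_le_mono) auto
        then show False using eq by simp
      qed
      then have "u' = u" by (rule inj_\<psi>)
      then show ?thesis using uw(3) by simp
    qed
    have "Poly_Mapping.lookup (f * g) (u + w) =
      (\<Sum>u'\<in>Poly_Mapping.keys f. \<Sum>w'\<in>Poly_Mapping.keys g.
        if u' = u \<and> w' = w then Poly_Mapping.lookup f u' * Poly_Mapping.lookup g w' else 0)"
      unfolding lookup_mult_keys using only by (intro sum.cong refl) auto
    also have "\<dots> = (\<Sum>u'\<in>Poly_Mapping.keys f. if u' = u then Poly_Mapping.lookup f u' * Poly_Mapping.lookup g w else 0)"
      using w(1) by (intro sum.cong refl) (auto simp: in_keys_iff)
    also have "\<dots> = Poly_Mapping.lookup f u * Poly_Mapping.lookup g w"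
      using u(1) by simp
    finally have "u + w \<in> Poly_Mapping.keys (f * g)"
      using u(1) w(1) by (auto simp: in_keys_iff)
    moreover have "Poly_Mapping.keys (u + w) \<subseteq> F" using u(1) w(1) by (simp add: keys_add_nat)
    ultimately show False using fg by (auto simp: support_ideal_def ring_of_type_algebra_def)
  qed
qed

definition facets :: "'v set set \<Rightarrow> 'v set set"
  where "facets N = {F. F \<notin> N \<and> (\<forall>v. v \<notin> F \<longrightarrow> insert v F \<in> N)}"

lemma face_subset_facet:
  fixes N :: "'v::finite set set"
  assumes "T \<notin> N"
  shows "\<exists>F\<in>facets N. T \<subseteq> F"
proof -
  let ?X = "{F. F \<notin> N \<and> T \<subseteq> F}"
  obtain F where F: "F \<in> ?X" "\<forall>G\<in>?X. F \<subseteq> G \<longrightarrow> F = G"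
    using finite_has_maximal[of ?X] assms by auto
  have "insert v F \<in> N" if "v \<notin> F" for v
    using F that by blast
  then show ?thesis using F(1) by (auto simp: facets_def)
qed

text \<open>
  For \<open>v \<notin> F\<close> the monomial of \<open>F\<close> times \<open>x\<^sub>v\<close> lies in the ideal, so a prime below the one of \<open>F\<close> contains
  \<open>x\<^sub>v\<close>.
\<close>

lemma facet_minimal_prime:
  fixes N :: "'v::finite set set"
  assumes up: "upward_closed N" and F: "F \<in> facets N"
  shows "(support_ideal {T. \<not> T \<subseteq> F} :: ('v, 'k::field) mpoly set) \<in>
    minimal_primes mpoly_ring (support_ideal N)"
  unfolding minimal_primes_def
proof (intro CollectI conjI allI impI)
  let ?P = "support_ideal {T. \<not> T \<subseteq> F} :: ('v, 'k) mpoly set"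
  show "primeideal ?P mpoly_ring" by (rule prime_support_ideal)
  have "\<not> T \<subseteq> F" if "T \<in> N" for T
    using F upward_closedD[OF up that] by (auto simp: facets_def)
  then show "support_ideal N \<subseteq> ?P" by (auto simp: support_ideal_def)
  fix Q :: "('v, 'k) mpoly set"
  assume "primeideal Q mpoly_ring \<and> support_ideal N \<subseteq> Q \<and> Q \<subseteq> ?P"
  then have prime: "primeideal Q mpoly_ring" and NQ: "support_ideal N \<subseteq> Q" and QP: "Q \<subseteq> ?P" by auto
  interpret primeideal Q mpoly_ring by (rule prime)
  have idQ: "ideal Q mpoly_ring" by (rule ideal_axioms)
  have prod: "f \<in> Q \<or> g \<in> Q" if "f * g \<in> Q" for f g
    using I_prime[of f g] that by (simp add: ring_of_type_algebra_def)
  have var: "monomial (Poly_Mapping.single v 1) \<in> Q" if v: "v \<notin> F" for v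
  proof -
    have "monomial (squarefree_exponent (insert v F)) \<in> (support_ideal N :: ('v, 'k) mpoly set)"
      using F v by (simp add: monomial_in_support_ideal_iff facets_def)
    then have "monomial (Poly_Mapping.single v 1) * monomial (squarefree_exponent F) \<in> Q"
      using NQ v by (auto simp: monomial_mult squarefree_exponent_insert)
    moreover have "monomial (squarefree_exponent F) \<notin> Q"
      using QP by (auto simp: monomial_in_support_ideal_iff)
    ultimately show ?thesis using prod by blast
  qed
  have "?P \<subseteq> Q"
  proof
    fix f assume f: "f \<in> ?P"
    have "(\<Sum>u\<in>Poly_Mapping.keys f. Poly_Mapping.single u (Poly_Mapping.lookup f u)) \<in> Q"
    proof (rule ideal_type_sum[OF idQ])
      fix u assume "u \<in> Poly_Mapping.keys f"
      then obtain v where v: "v \<in> Poly_Mapping.keys u" "v \<notin> F" using f by (auto simp: support_ideal_def)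
      have "(u - Poly_Mapping.single v 1) + Poly_Mapping.single v 1 = u"
        using v(1) by (intro poly_mapping_eqI) (auto simp: lookup_add lookup_minus lookup_single when_def in_keys_iff)
      then have "Poly_Mapping.single u (Poly_Mapping.lookup f u) =
          Poly_Mapping.single (u - Poly_Mapping.single v 1) (Poly_Mapping.lookup f u) *
          monomial (Poly_Mapping.single v 1)"
        by (simp add: monomial_def mult_single)
      then show "Poly_Mapping.single u (Poly_Mapping.lookup f u) \<in> Q"
        using ideal_type_mult[OF idQ var[OF v(2)]] by simp
    qed
    then show "f \<in> Q" by (simp add: poly_sum_single)
  qed
  then show "Q = ?P" using QP by blast
qed

text \<open>
  For the primes of three facets, this recovers the intersection of the facets from the sum of the primes.
\<close>

lemma var_in_support_ideal_sum_iff: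
  fixes P Q R :: "('v::finite, 'k::field) mpoly set"
  assumes "P = support_ideal N1" "Q = support_ideal N2" "R = support_ideal N3"
  shows "var v \<in> P <+>\<^bsub>mpoly_ring\<^esub> Q <+>\<^bsub>mpoly_ring\<^esub> R \<longleftrightarrow> {v} \<in> N1 \<union> N2 \<union> N3"
proof -
  have set_add: "A <+>\<^bsub>mpoly_ring\<^esub> B = {a + b |a b. a \<in> A \<and> b \<in> B}" for A B :: "('v, 'k) mpoly set"
    by (auto simp: set_add_def' ring_of_type_algebra_def)
  have sum: "P <+>\<^bsub>mpoly_ring\<^esub> Q <+>\<^bsub>mpoly_ring\<^esub> R = {a + b + c |a b c. a \<in> P \<and> b \<in> Q \<and> c \<in> R}"
    unfolding set_add by (auto; metis add.assoc)
  have zero: "0 \<in> P" "0 \<in> Q" "0 \<in> R" by (simp_all add: assms support_ideal_def)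
  have single: "Poly_Mapping.keys (Poly_Mapping.single v (1::nat)) = {v}" by simp
  have mem: "{v} \<in> N" if "p \<in> support_ideal N" "Poly_Mapping.single v 1 \<in> Poly_Mapping.keys p"
    for p :: "('v, 'k) mpoly" and N
  proof -
    have "Poly_Mapping.keys (Poly_Mapping.single v (1::nat)) \<in> N"
      using that unfolding support_ideal_def by blast
    then show ?thesis using single by simp
  qed
  show ?thesis
  proof
    assume "var v \<in> P <+>\<^bsub>mpoly_ring\<^esub> Q <+>\<^bsub>mpoly_ring\<^esub> R"
    then obtain a b c where abc: "var v = a + b + c" "a \<in> P" "b \<in> Q" "c \<in> R" unfolding sum by blast
    have "Poly_Mapping.single v 1 \<in> Poly_Mapping.keys (var v :: ('v, 'k) mpoly)" by (simp add: var_def)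
    then have "Poly_Mapping.single v 1 \<in> Poly_Mapping.keys a \<union> Poly_Mapping.keys b \<union> Poly_Mapping.keys c"
      unfolding abc(1) using Poly_Mapping.keys_add[of "a + b" c] Poly_Mapping.keys_add[of a b] by blast
    then show "{v} \<in> N1 \<union> N2 \<union> N3"
      using mem[of a N1] mem[of b N2] mem[of c N3] abc(2-4) unfolding assms by blast
  next
    assume "{v} \<in> N1 \<union> N2 \<union> N3"
    then have "var v \<in> P \<or> var v \<in> Q \<or> var v \<in> R"
      unfolding assms var_def monomial_in_support_ideal_iff single by blast
    then have "\<exists>a b c. var v = a + b + c \<and> a \<in> P \<and> b \<in> Q \<and> c \<in> R"
      using zero by (metis add.left_neutral add.right_neutral)
    then show "var v \<in> P <+>\<^bsub>mpoly_ring\<^esub> Q <+>\<^bsub>mpoly_ring\<^esub> R" unfolding sum by blast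
  qed
qed

theorem theorem3p5:
  fixes I J :: "('v::finite, 'k::field) mpoly set"
  assumes "squarefree_monomial_ideal I"
    and "I \<noteq> {0}"
    and "ideal J mpoly_ring"
    and "\<And>P Q R. P \<in> minimal_primes mpoly_ring I \<Longrightarrow> Q \<in> minimal_primes mpoly_ring I \<Longrightarrow>
           R \<in> minimal_primes mpoly_ring I \<Longrightarrow> P \<noteq> Q \<Longrightarrow> P \<noteq> R \<Longrightarrow> Q \<noteq> R \<Longrightarrow>
           P <+>\<^bsub>mpoly_ring\<^esub> Q <+>\<^bsub>mpoly_ring\<^esub> R = J"
  shows "enat (sdepth I) \<ge> depth mpoly_ring max_ideal I"
proof -
  obtain N where up: "upward_closed N" and I: "I = support_ideal N"
    by (rule squarefree_monomial_ideal_support[OF assms(1)])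
  have UNIV: "UNIV \<in> N"
  proof -
    obtain f where f: "f \<in> I" "f \<noteq> 0" using assms(2) I by (auto simp: support_ideal_def)
    then obtain u where "u \<in> Poly_Mapping.keys f" by fastforce
    then have "Poly_Mapping.keys u \<in> N" using f(1) by (simp add: I support_ideal_def)
    then show ?thesis using upward_closedD[OF up] by blast
  qed
  have NF: "N = {T. \<forall>F\<in>facets N. \<not> T \<subseteq> F}"
  proof (intro equalityI subsetI CollectI ballI notI)
    fix T F assume TF: "T \<in> N" "F \<in> facets N" "T \<subseteq> F"
    then have "F \<in> N" using upward_closedD[OF up] by simp
    then show False using TF(2) by (simp add: facets_def)
  next
    fix T assume "T \<in> {T. \<forall>F\<in>facets N. \<not> T \<subseteq> F}"
    then show "T \<in> N" using face_subset_facet[of T N] by auto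
  qed
  define P where "P F = (support_ideal {T. \<not> T \<subseteq> F} :: ('v, 'k) mpoly set)" for F
  have P_min: "P F \<in> minimal_primes mpoly_ring I" if "F \<in> facets N" for F
    unfolding P_def I by (rule facet_minimal_prime[OF up that])
  have P_inj: "F = G" if "P F = P G" for F G
  proof -
    have "monomial (squarefree_exponent T) \<in> P F \<longleftrightarrow> \<not> T \<subseteq> F" for T F
      by (simp add: P_def monomial_in_support_ideal_iff)
    then show ?thesis using that by blast
  qed
  have P_sum: "var v \<in> P F <+>\<^bsub>mpoly_ring\<^esub> P G <+>\<^bsub>mpoly_ring\<^esub> P H \<longleftrightarrow> v \<notin> F \<inter> G \<inter> H" for v F G H
    by (subst var_in_support_ideal_sum_iff[OF P_def P_def P_def]) auto
  have triple_J: "var v \<in> J \<longleftrightarrow> v \<notin> F \<inter> G \<inter> H"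
    if "F \<in> facets N" "G \<in> facets N" "H \<in> facets N" "F \<noteq> G" "F \<noteq> H" "G \<noteq> H" for F G H v
    using assms(4)[OF P_min P_min P_min, of F G H] P_sum[of v F G H] P_inj that by metis
  have bound: "length fs \<le> sdepth I"
    if reg: "regular_sequence_on mpoly_ring I fs" and fs: "set fs \<subseteq> max_ideal" for fs
  proof -
    have "partitionable (length fs) N"
    proof (cases "{} \<in> N")
      case True
      then have "N = UNIV" using upward_closedD[OF up] by blast
      then have "partitionable (card (UNIV :: 'v set)) N"
        by (intro partitionable_family[of "{()}" "\<lambda>_. {}" "\<lambda>_. UNIV"]) auto
      then show ?thesis
        using regular_sequence_length_le_card[OF up reg[unfolded I] fs True] partitionable_mono by blast
    next
      case False
      interpret facet_complex "facets N" "\<Inter> (facets N)" N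
      proof
        show "N = {T. \<forall>F\<in>facets N. \<not> T \<subseteq> F}" by (rule NF)
        show "facets N \<noteq> {}" using face_subset_facet[OF False] by blast
        show "UNIV \<notin> facets N" using UNIV by (simp add: facets_def)
        show "F = G" if FG: "F \<in> facets N" "G \<in> facets N" "F \<subseteq> G" for F G
        proof (rule ccontr)
          assume "F \<noteq> G"
          then obtain v where "v \<in> G" "v \<notin> F" using FG(3) by blast
          then have "insert v F \<in> N" "insert v F \<subseteq> G" using FG by (auto simp: facets_def)
          then have "G \<in> N" using upward_closedD[OF up] by simp
          then show False using FG(2) by (simp add: facets_def)
        qed
        show "F \<inter> G \<inter> H \<subseteq> \<Inter> (facets N)"
          if FGH: "F \<in> facets N" "G \<in> facets N" "H \<in> facets N" "F \<noteq> G" "F \<noteq> H" "G \<noteq> H" for F G H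
        proof
          fix v assume v: "v \<in> F \<inter> G \<inter> H"
          have "v \<in> K" if K: "K \<in> facets N" for K
          proof (cases "K \<in> {F, G, H}")
            case False
            then have "v \<in> F \<inter> G \<inter> K"
              using triple_J[OF FGH, of v] triple_J[OF FGH(1,2) K FGH(4), of v] v by blast
            then show ?thesis by blast
          qed (use v in blast)
          then show "v \<in> \<Inter> (facets N)" by blast
        qed
      qed simp
      show ?thesis by (rule partitionable_length[OF reg[unfolded I] fs])
    qed
    then show ?thesis
      using assms(2) unfolding I by (rule sdepth_ge_partitionable)
  qed
  show ?thesis
    unfolding depth_def by (rule SUP_least) (use bound in auto)
qed

end
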